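(* Let $p>3$ be a prime, $q=p^e$ with $q\equiv 1\pmod{12}$, and let $E: y^2=x^3+ax+b$ be an elliptic curve over $\mathbb{F}_q$ ($a,b\in\mathbb{F}_q$) with $j(E)\neq 0,1728$. Let $T$ be a generator of the character group $\widehat{\mathbb{F}_q^*}$. Then $$a(E(\mathbb{F}_q))=-q\cdot T^{\frac{q-1}{4}}\!\left(\frac{a^3}{27}\right)\cdot {}_2F_1\!\left(\left.\begin{array}{cc} T^{\frac{q-1}{12}} & T^{\frac{5(q-1)}{12}}\\ & T^{\frac{q-1}{2}}\end{array}\right|-\frac{27b^2}{4a^3}\right)_q.$$
   Context: Every multiplicative character $\chi\in\widehat{\mathbb{F}_q^*}$ is extended to all of $\mathbb{F}_q$ by $\chi(0)=0$. For characters $A,B$ define the normalized Jacobi sum $\binom{A}{B}:=\frac{B(-1)}{q}\sum_{x\in\mathbb{F}_q}A(x)\overline{B}(1-x)$. For characters $A_0,A_1,B_1$ and $x\in\mathbb{F}_q$, Greene's Gaussian hypergeometric series is $${}_2F_1\!\left(\left.\begin{array}{cc} A_0 & A_1\\ & B_1\end{array}\right| x\right)_q:=\frac{q}{q-1}\sum_{\chi\in\widehat{\mathbb{F}_q^*}}\binom{A_0\chi}{\chi}\binom{A_1\chi}{B_1\chi}\chi(x).$$ The trace of Frobenius is $a(E(\mathbb{F}_q)):=q+1-|E(\mathbb{F}_q)|$, where $|E(\mathbb{F}_q)|$ is the number of projective $\mathbb{F}_q$-points of $E$. (The condition $j(E)\neq 0,1728$ is equivalent to $a\neq0$ and $b\neq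 0$.) *)

theory Defs
  imports
    Complex_Main
    "HOL-Library.Cardinality"
    "HOL-Computational_Algebra.Primes"
    "HOL-Number_Theory.Cong"
    "HOL-Algebra.Generated_Groups"
begin

section \<open>Multiplicative characters of a finite field\<close>

text \<open>
  A character is represented by its extension by zero to the whole field. Every character
  vanishes at \<open>0\<close>, including the trivial one, which is why \<open>char_one\<close> is not constantly \<open>1\<close>.
\<close>

definition mult_char :: "('a :: finite_field \<Rightarrow> complex) \<Rightarrow> bool" where
  "mult_char \<chi> \<longleftrightarrow> \<chi> 0 = 0 \<and> (\<forall>x. x \<noteq> 0 \<longrightarrow> \<chi> x \<noteq> 0) \<and>
     (\<forall>x y. x \<noteq> 0 \<longrightarrow> y \<noteq> 0 \<longrightarrow> \<chi> (x * y) = \<chi> x * \<chi> y)"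

definition char_one :: "'a :: finite_field \<Rightarrow> complex" where
  "char_one x = (if x = 0 then 0 else 1)"

definition char_mult ::
  "('a :: finite_field \<Rightarrow> complex) \<Rightarrow> ('a \<Rightarrow> complex) \<Rightarrow> 'a \<Rightarrow> complex" where
  "char_mult A B x = A x * B x"

definition char_group :: "('a :: finite_field \<Rightarrow> complex) monoid" where
  "char_group = \<lparr>carrier = {\<chi>. mult_char \<chi>}, mult = char_mult, one = char_one\<rparr>"

definition char_generator :: "('a :: finite_field \<Rightarrow> complex) \<Rightarrow> bool" where
  "char_generator T \<longleftrightarrow>
     T \<in> carrier char_group \<and> generate char_group {T} = carrier char_group"

lemma char_group_simps:
  "carrier char_group = {\<chi>. mult_char \<chi>}"
  "mult char_group = char_mult"
  "one char_group = char_one"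
  by (simp_all add: char_group_def)

lemma mult_char_1:
  assumes "mult_char \<chi>"
  shows "\<chi> 1 = 1"
proof -
  have "\<chi> 1 = \<chi> 1 * \<chi> 1" "\<chi> 1 \<noteq> 0"
    using assms unfolding mult_char_def by (metis mult_1 one_neq_zero)+
  then show ?thesis by simp
qed

lemma comm_group_char_group: "comm_group (char_group :: ('a :: finite_field \<Rightarrow> complex) monoid)"
proof (rule comm_groupI)
  fix \<chi> :: "'a \<Rightarrow> complex"
  assume "\<chi> \<in> carrier char_group"
  then have \<chi>: "mult_char \<chi>" by (simp add: char_group_simps)
  have "mult_char (\<lambda>x. inverse (\<chi> x))"
    using \<chi> by (auto simp: mult_char_def)
  moreover have "char_mult (\<lambda>x. inverse (\<chi> x)) \<chi> = char_one"
    using \<chi> by (auto simp: char_mult_def char_one_def mult_char_def fun_eq_iff)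
  ultimately show "\<exists>\<psi>\<in>carrier char_group. \<psi> \<otimes>\<^bsub>char_group\<^esub> \<chi> = \<one>\<^bsub>char_group\<^esub>"
    by (auto simp: char_group_simps)
qed (auto simp: char_group_simps char_mult_def char_one_def mult_char_def fun_eq_iff)

lemma mult_char_power:
  assumes "mult_char \<chi>"
  shows "\<chi> (x ^ n) = (if n = 0 then 1 else \<chi> x ^ n)"
proof (cases "x = 0")
  case True
  then show ?thesis
    using assms mult_char_1[OF assms] by (auto simp: mult_char_def zero_power)
next
  case False
  have "\<chi> (x ^ n) = \<chi> x ^ n"
    by (induction n) (use False assms mult_char_1[OF assms] in \<open>auto simp: mult_char_def\<close>)
  then show ?thesis by simp
qed

lemma finite_char_group: "finite (carrier (char_group :: ('a :: finite_field \<Rightarrow> complex) monoid))"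
proof -
  let ?n = "CARD('a) - 1"
  have card2: "card {0, 1 :: 'a} \<le> CARD('a)"
    by (rule card_mono) auto
  then have n: "?n > 0" by simp
  have "\<chi> x = 0 \<or> \<chi> x ^ ?n = 1" if \<chi>: "mult_char \<chi>" for \<chi> and x :: 'a
  proof (cases "x = 0")
    case True
    then show ?thesis using \<chi> by (simp add: mult_char_def)
  next
    case False
    have "x ^ ?n * x = x ^ Suc ?n" by (rule power_Suc2 [symmetric])
    also have "Suc ?n = CARD('a)" using n by simp
    also have "x ^ CARD('a) = x" by (rule finite_field_power_card_eq_same)
    finally have "x ^ ?n * x = x" .
    with False have "x ^ ?n = 1" by simp
    then show ?thesis
      using mult_char_power[OF \<chi>, of x ?n] mult_char_1[OF \<chi>] n by simp
  qed
  then have "carrier char_group \<subseteq> {\<chi> :: 'a \<Rightarrow> complex. \<forall>x. \<chi> x \<in> {0} \<union> {z. z ^ ?n = 1}}"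
    by (auto simp: char_group_simps)
  moreover have "finite {z :: complex. z ^ ?n = 1}"
    using n by (intro finite_roots_unity) simp
  then have "finite {\<chi> :: 'a \<Rightarrow> complex. \<forall>x. \<chi> x \<in> {0} \<union> {z. z ^ ?n = 1}}"
    using finite_set_of_finite_funs[of "UNIV :: 'a set" "{0} \<union> {z :: complex. z ^ ?n = 1}"]
    by simp
  ultimately show ?thesis by (rule finite_subset)
qed


section \<open>Greene's hypergeometric series\<close>

definition jacobi_binom ::
  "('a :: finite_field \<Rightarrow> complex) \<Rightarrow> ('a \<Rightarrow> complex) \<Rightarrow> complex" where
  "jacobi_binom A B = B (-1) / of_nat (CARD('a)) * (\<Sum>x\<in>UNIV. A x * cnj (B (1 - x)))"

definition greene_2F1 ::
  "('a :: finite_field \<Rightarrow> complex) \<Rightarrow> ('a \<Rightarrow> complex) \<Rightarrow> ('a \<Rightarrow> complex) \<Rightarrow> 'a \<Rightarrow> complex" where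
  "greene_2F1 A0 A1 B1 x =
     of_nat (CARD('a)) / (of_nat (CARD('a)) - 1) *
     (\<Sum>\<chi>\<in>carrier char_group.
        jacobi_binom (A0 \<otimes>\<^bsub>char_group\<^esub> \<chi>) \<chi> *
        jacobi_binom (A1 \<otimes>\<^bsub>char_group\<^esub> \<chi>) (B1 \<otimes>\<^bsub>char_group\<^esub> \<chi>) * \<chi> x)"


section \<open>Elliptic curves in short Weierstrass form\<close>

text \<open>
  Points of the projective plane are classes of nonzero triples up to nonzero scalars.
\<close>

definition proj_rel :: "(('a :: field \<times> 'a \<times> 'a) \<times> ('a \<times> 'a \<times> 'a)) set" where
  "proj_rel = {((X, Y, Z), (X', Y', Z')).
     (X, Y, Z) \<noteq> (0, 0, 0) \<and> (\<exists>c. c \<noteq> 0 \<and> X' = c * X \<and> Y' = c * Y \<and> Z' = c * Z)}"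

definition proj_plane :: "('a :: field \<times> 'a \<times> 'a) set set" where
  "proj_plane = (UNIV - {(0, 0, 0)}) // proj_rel"

lemma equiv_proj_rel: "equiv (UNIV - {(0, 0, 0)}) (proj_rel :: (('a :: field \<times> 'a \<times> 'a) \<times> _) set)"
proof (rule equivI)
  show "proj_rel \<subseteq> (UNIV - {(0, 0, 0)}) \<times> (UNIV - {(0, 0, 0 :: 'a)})"
    by (auto simp: proj_rel_def)
  show "refl_on (UNIV - {(0, 0, 0)}) (proj_rel :: (('a \<times> 'a \<times> 'a) \<times> _) set)"
    by (auto simp: refl_on_def proj_rel_def intro!: exI[of _ 1])
  show "sym (proj_rel :: (('a \<times> 'a \<times> 'a) \<times> _) set)"
  proof (rule symI)
    fix u v :: "'a \<times> 'a \<times> 'a"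
    assume "(u, v) \<in> proj_rel"
    then obtain X Y Z c where "u = (X, Y, Z)" "v = (c * X, c * Y, c * Z)" "c \<noteq> 0"
        "(X, Y, Z) \<noteq> (0, 0, 0)"
      by (auto simp: proj_rel_def)
    then show "(v, u) \<in> proj_rel"
      by (auto simp: proj_rel_def intro!: exI[of _ "inverse c"])
  qed
  show "trans (proj_rel :: (('a \<times> 'a \<times> 'a) \<times> _) set)"
  proof (rule transI)
    fix u v w :: "'a \<times> 'a \<times> 'a"
    assume "(u, v) \<in> proj_rel" "(v, w) \<in> proj_rel"
    then obtain X Y Z c d where "u = (X, Y, Z)" "c \<noteq> 0" "d \<noteq> 0" "(X, Y, Z) \<noteq> (0, 0, 0)"
        "w = (d * (c * X), d * (c * Y), d * (c * Z))"
      by (auto simp: proj_rel_def)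
    then show "(u, w) \<in> proj_rel"
      by (auto simp: proj_rel_def mult.assoc intro!: exI[of _ "d * c"])
  qed
qed

definition ell_points :: "'a :: field \<Rightarrow> 'a \<Rightarrow> ('a \<times> 'a \<times> 'a) set set" where
  "ell_points a b =
     {P \<in> proj_plane. \<forall>(X, Y, Z)\<in>P. Y ^ 2 * Z = X ^ 3 + a * X * Z ^ 2 + b * Z ^ 3}"

definition ell_disc :: "'a :: field \<Rightarrow> 'a \<Rightarrow> 'a" where
  "ell_disc a b = - 16 * (4 * a ^ 3 + 27 * b ^ 2)"

text \<open>
  This is the usual nonsingularity condition, adequate in characteristic different from \<open>2\<close>.
\<close>

definition elliptic_curve :: "'a :: field \<Rightarrow> 'a \<Rightarrow> bool" where
  "elliptic_curve a b \<longleftrightarrow> ell_disc a b \<noteq> 0"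

definition ell_j :: "'a :: field \<Rightarrow> 'a \<Rightarrow> 'a" where
  "ell_j a b = - 1728 * (4 * a) ^ 3 / ell_disc a b"

definition frob_trace :: "'a :: finite_field \<Rightarrow> 'a \<Rightarrow> int" where
  "frob_trace a b = int (CARD('a)) + 1 - int (card (ell_points a b))"

end

theory Submission
  imports Defs "HOL-Algebra.Multiplicative_Group" "HOL-Number_Theory.Residues"
begin

text \<open>
  Write \<open>A = T\<^bsup>(q-1)/12\<^esup>\<close>, \<open>\<phi> = A\<^sup>6\<close>, \<open>m = -a/3\<close> and \<open>d = m\<^sup>3\<close>. Up to sign the trace of Frobenius is the sum
  of \<open>\<phi>(X\<^sup>3 - 3mX + b)\<close> over \<open>X\<close>. By Cardano's formula the number of roots of \<open>X\<^sup>3 - 3mX = c\<close> is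
  \<open>1\<close> plus the sum of the cubic character \<open>A\<^sup>8\<close> over the \<open>z\<close> with \<open>z + d/z = c\<close>. This turns the trace
  into the sum of \<open>A\<^sup>2(z) \<phi>(z\<^sup>2 + bz + d)\<close>, a finite field Legendre function.

  On the other side, orthogonality of characters rewrites Greene's series as \<open>1/q\<close> times the sum of
  \<open>A\<^sup>5(t) A(1+t) A\<^sup>-\<^sup>1(1+xt)\<close>, where \<open>x = b\<^sup>2/(4d)\<close>. Grouping the terms by the value of
  \<open>(1+t)/(t(1+xt))\<close> gives a quadratic transformation, which identifies this sum with the previous one.
  No Gauss sums and no Hasse--Davenport relation are needed.
\<close>

section \<open>Characters of a finite field\<close>

text \<open>The type is repackaged as a record field, so that the known cyclicity of the
  multiplicative group of a finite field applies to \<open>mult_of R\<close>.\<close>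

lemma finite_field_primitive_root:
  obtains g :: "'a :: finite_field"
  where "g \<noteq> 0" "\<And>x. x \<noteq> 0 \<Longrightarrow> \<exists>i. x = g ^ i"
proof -
  define R :: "'a ring" where
    "R = \<lparr>carrier = UNIV, mult = (*), one = 1, zero = 0, add = (+)\<rparr>"
  have "abelian_group R"
    by (rule abelian_groupI)
       (auto simp: R_def algebra_simps intro!: exI[of _ "- x" for x])
  moreover have "comm_monoid R"
    by (rule comm_monoidI) (auto simp: R_def algebra_simps)
  ultimately interpret R: cring R
    by (rule cringI) (auto simp: R_def algebra_simps)
  have "Units R = carrier R - {\<zero>\<^bsub>R\<^esub>}"
    by (auto simp: Units_def R_def) (metis left_inverse right_inverse)
  then interpret R: Ring.field R
    by (rule R.cring_fieldI)
  have pow: "x [^]\<^bsub>R\<^esub> (n :: nat) = x ^ n" for x n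
    by (induction n) (simp_all add: R_def nat_pow_def mult.commute)
  have "finite (carrier R)" by simp
  from R.finite_field_mult_group_has_gen[OF this] obtain g
    where g: "g \<in> carrier (mult_of R)"
      and gen: "carrier (mult_of R) = {g [^]\<^bsub>R\<^esub> i |i::nat. i \<in> UNIV}"
    by blast
  show ?thesis
  proof
    show "g \<noteq> 0" using g by (simp add: R_def)
    show "\<exists>i. x = g ^ i" if "x \<noteq> 0" for x
    proof -
      from that have "x \<in> carrier (mult_of R)" by (simp add: R_def)
      then show ?thesis unfolding gen pow by blast
    qed
  qed
qed

lemma finite_field_power_card_minus_1:
  fixes x :: "'a :: finite_field"
  assumes "x \<noteq> 0"
  shows "x ^ (CARD('a) - 1) = 1"
proof -
  have "Suc (CARD('a) - 1) = CARD('a)"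
    using card_gt_0_iff[of "UNIV :: 'a set"] by simp
  then have "x ^ (CARD('a) - 1) * x = x ^ CARD('a)"
    by (metis power_Suc2)
  then show ?thesis
    using assms by (simp add: finite_field_power_card_eq_same)
qed

lemma finite_field_card_gt_1: "CARD('a :: finite_field) > 1"
proof -
  have "card {0, 1 :: 'a} \<le> CARD('a)"
    by (rule card_mono) auto
  then show ?thesis by simp
qed

section \<open>Values and sums of a single extended character\<close>

context
  fixes \<chi> :: "'a :: finite_field \<Rightarrow> complex"
  assumes \<chi>: "mult_char \<chi>"
begin

lemma mult_char_0: "\<chi> 0 = 0"
  using \<chi> by (simp add: mult_char_def)

lemma mult_char_eq_0_iff: "\<chi> x = 0 \<longleftrightarrow> x = 0"
  using \<chi> by (auto simp: mult_char_def)

lemma mult_char_mult: "\<chi> (x * y) = \<chi> x * \<chi> y"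
  using \<chi> by (cases "x = 0"; cases "y = 0") (auto simp: mult_char_def)

lemma mult_char_pow: "n > 0 \<Longrightarrow> \<chi> (x ^ n) = \<chi> x ^ n"
  using mult_char_power[OF \<chi>, of x n] by simp

lemma mult_char_order: "x \<noteq> 0 \<Longrightarrow> \<chi> x ^ (CARD('a) - 1) = 1"
  using mult_char_pow[of "CARD('a) - 1" x] finite_field_card_gt_1[where 'a = 'a]
    finite_field_power_card_minus_1[of x]
  by (simp add: mult_char_1[OF \<chi>])

lemma norm_mult_char: "x \<noteq> 0 \<Longrightarrow> cmod (\<chi> x) = 1"
  using power_eq_1_iff mult_char_order finite_field_card_gt_1[where 'a = 'a] by fastforce

lemma mult_char_mult_cnj: "\<chi> x * cnj (\<chi> x) = (if x = 0 then 0 else 1)"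
  by (simp add: complex_norm_square[symmetric] norm_mult_char mult_char_0)

text \<open>Nonzero values lie on the unit circle. The convention \<open>inverse 0 = 0\<close> makes
  the identity valid at 0 too, so later rewriting needs no case split there.\<close>

lemma cnj_mult_char: "cnj (\<chi> x) = inverse (\<chi> x)"
  using mult_char_mult_cnj[of x]
  by (cases "x = 0") (auto simp: mult_char_0 inverse_unique)

lemma mult_char_inverse: "\<chi> (inverse x) = inverse (\<chi> x)"
  using mult_char_mult[of x "inverse x"]
  by (cases "x = 0") (auto simp: mult_char_0 mult_char_1[OF \<chi>] intro!: inverse_unique[symmetric])

lemma mult_char_divide: "\<chi> (x / y) = \<chi> x / \<chi> y"
  by (simp add: divide_inverse mult_char_mult mult_char_inverse)

lemma mult_char_minus_1_squared: "\<chi> (-1) ^ 2 = 1"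
  using mult_char_pow[of 2 "-1"] mult_char_1[OF \<chi>] by simp

text \<open>Replacing \<open>x\<close> by \<open>y * x\<close> for some \<open>y\<close> with
  \<open>\<chi> y \<noteq> 1\<close> multiplies the sum by \<open>\<chi> y\<close>.\<close>

lemma sum_mult_char:
  assumes "\<chi> \<noteq> char_one"
  shows "(\<Sum>x\<in>UNIV. \<chi> x) = 0"
proof -
  from assms obtain y where y: "y \<noteq> 0" "\<chi> y \<noteq> 1"
    by (auto simp: fun_eq_iff char_one_def mult_char_0 split: if_splits)
  have "(\<Sum>x\<in>UNIV. \<chi> x) = (\<Sum>x\<in>UNIV. \<chi> (y * x))"
    by (rule sum.reindex_bij_witness[of _ "\<lambda>x. y * x" "\<lambda>x. x / y"]) (use y in auto)
  also have "\<dots> = \<chi> y * (\<Sum>x\<in>UNIV. \<chi> x)"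
    by (simp add: mult_char_mult sum_distrib_left)
  finally show ?thesis using y by simp
qed

end

lemma mult_char_char_one: "mult_char char_one"
  by (auto simp: mult_char_def char_one_def)

text \<open>The exponent must be positive: the zeroth power is \<open>char_one\<close>, which
  vanishes at 0, whereas \<open>T 0 ^ 0 = 1\<close>.\<close>

lemma char_group_nat_pow:
  assumes "mult_char T" and "n > 0"
  shows "(T [^]\<^bsub>char_group\<^esub> (n :: nat)) x = T x ^ n"
  using assms(2)
proof (induction n rule: nat_induct_non_zero)
  case 1
  show ?case
    using mult_char_0[OF assms(1)]
    by (simp add: nat_pow_def char_group_simps char_mult_def char_one_def)
next
  case (Suc n)
  then show ?case
    by (simp add: nat_pow_def char_group_simps char_mult_def)
qed

lemma mult_char_nat_pow:
  assumes "mult_char T"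
  shows "mult_char (T [^]\<^bsub>char_group\<^esub> (n :: nat))"
proof -
  interpret comm_group "char_group :: ('a \<Rightarrow> complex) monoid"
    by (rule comm_group_char_group)
  show ?thesis
    using nat_pow_closed[of T n] assms by (simp add: char_group_simps)
qed

section \<open>Generators of the character group are faithful\<close>

lemma ex_mult_char_primitive:
  fixes g :: "'a :: finite_field"
  assumes "g \<noteq> 0" and gen: "\<And>x. x \<noteq> 0 \<Longrightarrow> \<exists>i. x = g ^ i"
  obtains \<chi> where "mult_char \<chi>" "\<And>k. \<chi> g ^ k = 1 \<Longrightarrow> CARD('a) - 1 dvd k"
proof -
  let ?n = "CARD('a) - 1"
  have n: "?n > 0" using finite_field_card_gt_1[where 'a = 'a] by simp
  \<comment> \<open>Pigeonhole: the first \<open>?n\<close> powers of \<open>g\<close> already cover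
    all \<open>?n\<close> nonzero elements, so they are distinct.\<close>
  have inj: "[i = j] (mod ?n)" if "g ^ i = g ^ j" for i j
  proof -
    have red: "g ^ i = g ^ (i mod ?n)" for i
    proof -
      have "g ^ i = g ^ (?n * (i div ?n) + i mod ?n)" by simp
      also have "\<dots> = (g ^ ?n) ^ (i div ?n) * g ^ (i mod ?n)"
        by (simp only: power_add power_mult)
      finally show ?thesis
        by (simp only: finite_field_power_card_minus_1[OF assms(1)] power_one mult_1)
    qed
    have "UNIV - {0} \<subseteq> (\<lambda>i. g ^ i) ` {..<?n}"
    proof
      fix x :: 'a assume "x \<in> UNIV - {0}"
      then obtain i where "x = g ^ i" using gen by blast
      then have "x = g ^ (i mod ?n)" using red by simp
      then show "x \<in> (\<lambda>i. g ^ i) ` {..<?n}" using n by auto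
    qed
    moreover have "(\<lambda>i. g ^ i) ` {..<?n} \<subseteq> UNIV - {0}" using assms(1) by auto
    ultimately have "(\<lambda>i. g ^ i) ` {..<?n} = UNIV - {0}" by blast
    then have "card ((\<lambda>i. g ^ i) ` {..<?n}) = card {..<?n}"
      by (simp add: card_Diff_singleton)
    then have "inj_on (\<lambda>i. g ^ i) {..<?n}" by (intro eq_card_imp_inj_on) auto
    moreover have "g ^ (i mod ?n) = g ^ (j mod ?n)" using that red by metis
    ultimately show ?thesis using n by (simp add: inj_on_def cong_def)
  qed
  define \<zeta> where "\<zeta> = cis (2 * pi / real ?n)"
  have \<zeta>_pow: "\<zeta> ^ k = cis (2 * pi * real k / real ?n)" for k
    by (simp add: \<zeta>_def DeMoivre mult_ac)
  have \<zeta>_red: "\<zeta> ^ i = \<zeta> ^ (i mod ?n)" for i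
  proof -
    have "\<zeta> ^ i = \<zeta> ^ (?n * (i div ?n) + i mod ?n)" by simp
    also have "\<dots> = (\<zeta> ^ ?n) ^ (i div ?n) * \<zeta> ^ (i mod ?n)"
      by (simp only: power_add power_mult)
    also have "\<zeta> ^ ?n = 1"
      unfolding \<zeta>_pow using n by simp
    finally show ?thesis by simp
  qed
  have \<zeta>: "?n dvd k" if "\<zeta> ^ k = 1" for k
  proof -
    have inj_\<zeta>: "inj_on (\<lambda>k. \<zeta> ^ k) {..<?n}"
      using bij_betw_roots_unity[OF n] unfolding \<zeta>_pow by (simp add: bij_betw_def)
    have "\<zeta> ^ (k mod ?n) = \<zeta> ^ 0" using that \<zeta>_red[of k] by simp
    then have "k mod ?n = 0"
      by (rule inj_onD[OF inj_\<zeta>]) (use n in auto)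
    then show ?thesis by auto
  qed
  have \<zeta>_cong: "\<zeta> ^ i = \<zeta> ^ j" if "[i = j] (mod ?n)" for i j
    using that \<zeta>_red by (metis cong_def)
  \<comment> \<open>The chosen exponent is determined only modulo \<open>?n\<close>; this suffices
    since \<open>\<zeta>\<close> is a root of unity of order \<open>?n\<close>.\<close>
  define dlog where "dlog x = (SOME i. x = g ^ i)" for x
  have dlog: "g ^ dlog x = x" if "x \<noteq> 0" for x
    unfolding dlog_def using someI_ex[OF gen[OF that]] by simp
  define \<chi> where "\<chi> x = (if x = 0 then 0 else \<zeta> ^ dlog x)" for x
  have "mult_char \<chi>"
    unfolding mult_char_def
  proof (intro conjI allI impI)
    fix x y :: 'a assume "x \<noteq> 0" "y \<noteq> 0"
    then have "g ^ dlog (x * y) = g ^ (dlog x + dlog y)"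
      by (simp add: dlog power_add)
    then have "\<zeta> ^ dlog (x * y) = \<zeta> ^ (dlog x + dlog y)"
      using inj \<zeta>_cong by blast
    then show "\<chi> (x * y) = \<chi> x * \<chi> y"
      using \<open>x \<noteq> 0\<close> \<open>y \<noteq> 0\<close> by (simp add: \<chi>_def power_add)
  qed (auto simp: \<chi>_def \<zeta>_def)
  moreover have "\<chi> g = \<zeta>"
  proof -
    have "g ^ dlog g = g ^ 1" using dlog[OF assms(1)] by simp
    then have "\<zeta> ^ dlog g = \<zeta> ^ 1" using inj \<zeta>_cong by blast
    then show ?thesis using assms(1) by (simp add: \<chi>_def)
  qed
  ultimately show ?thesis using that[of \<chi>] \<zeta> by presburger
qed

text \<open>If \<open>T g ^ k = 1\<close>, then every character generated by \<open>T\<close> takes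
  at \<open>g\<close> a value with \<open>k\<close>-th power 1. One of these characters has a value
  of full order at \<open>g\<close>.\<close>

lemma char_generator_primitive:
  fixes g :: "'a :: finite_field"
  assumes T: "char_generator T" and g: "g \<noteq> 0" "\<And>x. x \<noteq> 0 \<Longrightarrow> \<exists>i. x = g ^ i"
    and k: "T g ^ k = 1"
  shows "CARD('a) - 1 dvd k"
proof -
  interpret G: comm_group "char_group :: ('a \<Rightarrow> complex) monoid"
    by (rule comm_group_char_group)
  obtain \<chi> where \<chi>: "mult_char \<chi>" "\<And>k. \<chi> g ^ k = 1 \<Longrightarrow> CARD('a) - 1 dvd k"
    using ex_mult_char_primitive[OF g] by blast
  have Tc: "T \<in> carrier char_group" using T by (simp add: char_generator_def)
  have "\<psi> g ^ k = 1" if "\<psi> \<in> generate char_group {T}" for \<psi>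
    using that
  proof (induction rule: generate.induct)
    case one
    show ?case using g(1) by (simp add: char_group_simps char_one_def)
  next
    case (incl h)
    then show ?case using k by simp
  next
    case (inv h)
    then have "inv\<^bsub>char_group\<^esub> T \<otimes>\<^bsub>char_group\<^esub> T = \<one>\<^bsub>char_group\<^esub>"
      using Tc by simp
    then have "(inv\<^bsub>char_group\<^esub> T) g * T g = 1"
      using g(1) by (simp add: char_group_simps char_mult_def char_one_def fun_eq_iff split: if_splits)
    then have "(inv\<^bsub>char_group\<^esub> T) g ^ k * T g ^ k = 1"
      by (simp flip: power_mult_distrib)
    then show ?case using inv k by simp
  next
    case (eng h1 h2)
    then show ?case by (simp add: char_group_simps char_mult_def power_mult_distrib)
  qed
  moreover have "\<chi> \<in> generate char_group {T}"
    using T \<chi>(1) by (simp add: char_generator_def char_group_simps)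
  ultimately show ?thesis using \<chi>(2) by blast
qed

text \<open>For \<open>x = g ^ i\<close> the hypothesis forces \<open>k * n\<close> to divide
  \<open>i * n\<close>, hence \<open>k\<close> to divide \<open>i\<close>.\<close>

lemma char_generator_eq_1_imp_power:
  fixes T :: "'a :: finite_field \<Rightarrow> complex"
  assumes T: "char_generator T" and "x \<noteq> 0" and "T x ^ n = 1" and "CARD('a) - 1 = k * n"
  shows "\<exists>y. x = y ^ k"
proof -
  obtain g :: 'a where g: "g \<noteq> 0" "\<And>x. x \<noteq> 0 \<Longrightarrow> \<exists>i. x = g ^ i"
    by (rule finite_field_primitive_root) blast
  obtain i where i: "x = g ^ i" using g(2)[OF assms(2)] by blast
  have Tm: "mult_char T" using T by (simp add: char_generator_def char_group_simps)
  have "T (g ^ i) = T g ^ i"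
    using mult_char_power[OF Tm, of g i] by simp
  then have "T g ^ (i * n) = 1" using assms(3) i by (simp add: power_mult)
  then have "k * n dvd i * n"
    using char_generator_primitive[OF T g] assms(4) by metis
  moreover have "n > 0" using assms(4) finite_field_card_gt_1[where 'a = 'a]
    by (cases n) auto
  ultimately have "k dvd i" by simp
  then obtain j where "i = j * k" by (metis dvd_def mult.commute)
  then show ?thesis using i by (auto simp: power_mult)
qed

lemma char_generator_faithful:
  assumes "char_generator T" and "x \<noteq> 0" and "T x = 1"
  shows "x = (1 :: 'a :: finite_field)"
proof -
  obtain y where "x = y ^ (CARD('a) - 1)"
    using char_generator_eq_1_imp_power[OF assms(1,2), of 1 "CARD('a) - 1"] assms(3) by auto
  moreover have "y \<noteq> 0" using calculation assms(2) finite_field_card_gt_1[where 'a = 'a]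
    by (auto simp: zero_power)
  ultimately show ?thesis using finite_field_power_card_minus_1 by blast
qed

text \<open>For \<open>w \<noteq> 1\<close>, multiplying all characters by \<open>T\<close> scales
  the sum by \<open>T w \<noteq> 1\<close>. The value at 1, the number of characters, follows by
  summing over all \<open>w\<close> and \<open>\<chi>\<close> in both orders: one order leaves only
  \<open>w = 1\<close>, the other only the trivial character.\<close>

lemma sum_char_group:
  fixes w :: "'a :: finite_field" and T :: "'a \<Rightarrow> complex"
  assumes T: "char_generator T" and w: "w \<noteq> 0"
  shows "(\<Sum>\<chi>\<in>carrier char_group. \<chi> w) = (if w = 1 then of_nat (CARD('a) - 1) else 0)"
proof -
  interpret G: comm_group "char_group :: ('a \<Rightarrow> complex) monoid"
    by (rule comm_group_char_group)
  let ?C = "carrier (char_group :: ('a \<Rightarrow> complex) monoid)"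
  have Tc: "T \<in> ?C" using T by (simp add: char_generator_def)
  have *: "(\<Sum>\<chi>\<in>?C. \<chi> w) = 0" if "w \<noteq> 0" "w \<noteq> 1" for w
  proof -
    have "(\<Sum>\<chi>\<in>?C. \<chi> w) = (\<Sum>\<chi>\<in>?C. (T \<otimes>\<^bsub>char_group\<^esub> \<chi>) w)"
      by (rule sum.reindex_bij_witness[of _ "\<lambda>\<chi>. T \<otimes>\<^bsub>char_group\<^esub> \<chi>"
            "\<lambda>\<chi>. inv\<^bsub>char_group\<^esub> T \<otimes>\<^bsub>char_group\<^esub> \<chi>"])
         (use Tc in \<open>auto simp: G.m_assoc[symmetric]\<close>)
    also have "\<dots> = T w * (\<Sum>\<chi>\<in>?C. \<chi> w)"
      by (simp add: char_group_simps char_mult_def sum_distrib_left)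
    finally show ?thesis
      using char_generator_faithful[OF T that(1)] that(2) by auto
  qed
  have "(\<Sum>\<chi>\<in>?C. \<chi> 1) = (\<Sum>w\<in>{1}. \<Sum>\<chi>\<in>?C. \<chi> w)"
    by simp
  also have "\<dots> = (\<Sum>w\<in>UNIV. \<Sum>\<chi>\<in>?C. \<chi> w)"
  proof (rule sum.mono_neutral_left)
    show "\<forall>w\<in>UNIV - {1}. (\<Sum>\<chi>\<in>?C. \<chi> w) = 0"
    proof
      fix w :: 'a assume "w \<in> UNIV - {1}"
      then show "(\<Sum>\<chi>\<in>?C. \<chi> w) = 0"
        using *[of w] by (cases "w = 0") (simp_all add: char_group_simps mult_char_0)
    qed
  qed auto
  also have "\<dots> = (\<Sum>\<chi>\<in>?C. \<Sum>w\<in>UNIV. \<chi> w)"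
    by (rule sum.swap)
  also have "\<dots> = (\<Sum>\<chi>\<in>{char_one}. \<Sum>w :: 'a\<in>UNIV. \<chi> w)"
    by (rule sum.mono_neutral_right[OF finite_char_group])
       (auto simp: char_group_simps sum_mult_char mult_char_char_one)
  also have "\<dots> = of_nat (card (UNIV - {0 :: 'a}))"
    by (simp add: char_one_def sum.If_cases Compl_eq_Diff_UNIV)
  finally show ?thesis using *[OF w] by (auto simp: card_Diff_singleton)
qed

section \<open>The integral representation of Greene's series\<close>

text \<open>The substitution \<open>u = t / (1 + t)\<close> gives
  \<open>1 - u = 1 / (1 + t)\<close>, and the two factors \<open>\<chi> (1 + t)\<close> cancel. What
  remains depends on \<open>\<chi>\<close> only through \<open>\<chi> (-1)\<close> and
  \<open>\<chi> t\<close>, the form in which orthogonality can be applied.\<close>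

lemma jacobi_binom_mult:
  fixes A B \<chi> :: "'a :: finite_field \<Rightarrow> complex"
  assumes "mult_char A" "mult_char B" "mult_char \<chi>"
  shows "jacobi_binom (char_mult A \<chi>) (char_mult B \<chi>) =
           B (-1) * \<chi> (-1) / of_nat (CARD('a)) *
           (\<Sum>t\<in>UNIV. A t * cnj (A (1 + t)) * B (1 + t) * \<chi> t)"
proof -
  have "(\<Sum>u\<in>UNIV. char_mult A \<chi> u * cnj (char_mult B \<chi> (1 - u))) =
        (\<Sum>u\<in>UNIV - {1}. char_mult A \<chi> u * cnj (char_mult B \<chi> (1 - u)))"
    by (rule sum.mono_neutral_right) (auto simp: char_mult_def mult_char_0[OF assms(3)])
  also have "\<dots> = (\<Sum>t\<in>UNIV - {-1}. A t * cnj (A (1 + t)) * B (1 + t) * \<chi> t)"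
  proof (rule sum.reindex_bij_witness[of _ "\<lambda>t. t / (1 + t)" "\<lambda>u. u / (1 - u)"])
    fix u :: 'a assume u: "u \<in> UNIV - {1}"
    then have u1: "1 - u \<noteq> 0" by simp
    have 1: "1 + u / (1 - u) = 1 / (1 - u)" using u1 by (simp add: field_simps)
    show "u / (1 - u) / (1 + u / (1 - u)) = u" unfolding 1 using u1 by simp
    have "1 / (1 - u) \<noteq> 0" using u1 by simp
    then show "u / (1 - u) \<in> UNIV - {-1}" using 1 by (auto simp: add_eq_0_iff)
    have "A (u / (1 - u)) * cnj (A (1 / (1 - u))) = A u"
      using u1 by (simp add: mult_char_divide[OF assms(1)] cnj_mult_char[OF assms(1)]
          mult_char_1[OF assms(1)] mult_char_eq_0_iff[OF assms(1)])
    moreover have "B (1 / (1 - u)) = cnj (B (1 - u))"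
      by (simp add: mult_char_divide[OF assms(2)] cnj_mult_char[OF assms(2)]
          mult_char_1[OF assms(2)] inverse_eq_divide)
    moreover have "\<chi> (u / (1 - u)) = \<chi> u * cnj (\<chi> (1 - u))"
      by (simp add: mult_char_divide[OF assms(3)] cnj_mult_char[OF assms(3)] inverse_eq_divide)
    ultimately show "A (u / (1 - u)) * cnj (A (1 + u / (1 - u))) * B (1 + u / (1 - u)) *
        \<chi> (u / (1 - u)) = char_mult A \<chi> u * cnj (char_mult B \<chi> (1 - u))"
      unfolding 1 char_mult_def by simp
  next
    fix t :: 'a assume t: "t \<in> UNIV - {-1}"
    then have t1: "1 + t \<noteq> 0" by (auto simp: add_eq_0_iff)
    have 1: "1 - t / (1 + t) = 1 / (1 + t)" using t1 by (simp add: field_simps)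
    show "t / (1 + t) / (1 - t / (1 + t)) = t" unfolding 1 using t1 by simp
    have "1 / (1 + t) \<noteq> 0" using t1 by simp
    then show "t / (1 + t) \<in> UNIV - {1}" using 1 by auto
  qed
  also have "\<dots> = (\<Sum>t\<in>UNIV. A t * cnj (A (1 + t)) * B (1 + t) * \<chi> t)"
    by (rule sum.mono_neutral_left) (auto simp: mult_char_0[OF assms(1)])
  finally show ?thesis
    by (simp add: jacobi_binom_def char_mult_def)
qed

lemma greene_2F1_eq_sum:
  fixes A0 A1 B1 T :: "'a :: finite_field \<Rightarrow> complex"
  assumes T: "char_generator T"
    and A0: "mult_char A0" and A1: "mult_char A1" and B1: "mult_char B1" and x: "x \<noteq> 0"
  shows "greene_2F1 A0 A1 B1 x = B1 (-1) / of_nat (CARD('a)) *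
           (\<Sum>t\<in>UNIV. A1 t * cnj (A1 (1 + t)) * B1 (1 + t) * cnj (A0 (1 + x * t)))"
proof -
  let ?C = "carrier (char_group :: ('a \<Rightarrow> complex) monoid)"
  let ?q = "of_nat (CARD('a)) :: complex"
  define F where "F s = A0 s * cnj (A0 (1 + s))" for s
  define G where "G t = A1 t * cnj (A1 (1 + t)) * B1 (1 + t)" for t
  have q: "?q \<noteq> 0" "?q - 1 \<noteq> 0"
    using finite_field_card_gt_1[where 'a = 'a] by (auto simp flip: of_nat_1_eq_iff)
  have "jacobi_binom (A0 \<otimes>\<^bsub>char_group\<^esub> \<chi>) \<chi> *
        jacobi_binom (A1 \<otimes>\<^bsub>char_group\<^esub> \<chi>) (B1 \<otimes>\<^bsub>char_group\<^esub> \<chi>) * \<chi> x =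
        B1 (-1) / ?q ^ 2 * (\<Sum>t\<in>UNIV. \<Sum>s\<in>UNIV. F s * G t * \<chi> (x * s * t))"
    if "\<chi> \<in> ?C" for \<chi>
  proof -
    have \<chi>: "mult_char \<chi>" using that by (simp add: char_group_simps)
    \<comment> \<open>Inserting the trivial character brings the first binomial into the shape of
      \<open>jacobi_binom_mult\<close>. The resulting factor \<open>char_one (1 + s)\<close> is
      harmless because \<open>F\<close> vanishes at \<open>s = -1\<close>.\<close>
    have "char_mult char_one \<chi> = \<chi>"
      using mult_char_0[OF \<chi>] by (auto simp: char_mult_def char_one_def)
    then have "jacobi_binom (char_mult A0 \<chi>) \<chi> = \<chi> (-1) / ?q *
        (\<Sum>s\<in>UNIV. A0 s * cnj (A0 (1 + s)) * char_one (1 + s) * \<chi> s)"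
      using jacobi_binom_mult[OF A0 mult_char_char_one \<chi>] by (simp add: char_one_def)
    also have "(\<Sum>s\<in>UNIV. A0 s * cnj (A0 (1 + s)) * char_one (1 + s) * \<chi> s) =
        (\<Sum>s\<in>UNIV. F s * \<chi> s)"
      by (rule sum.cong) (auto simp: F_def char_one_def mult_char_0[OF A0])
    finally have 1: "jacobi_binom (char_mult A0 \<chi>) \<chi> =
        \<chi> (-1) / ?q * (\<Sum>s\<in>UNIV. F s * \<chi> s)" .
    have 2: "jacobi_binom (char_mult A1 \<chi>) (char_mult B1 \<chi>) =
        B1 (-1) * \<chi> (-1) / ?q * (\<Sum>t\<in>UNIV. G t * \<chi> t)"
      by (simp add: jacobi_binom_mult[OF A1 B1 \<chi>] G_def)
    have "jacobi_binom (char_mult A0 \<chi>) \<chi> * jacobi_binom (char_mult A1 \<chi>) (char_mult B1 \<chi>) * \<chi> x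
        = (\<chi> (-1))\<^sup>2 * B1 (-1) / ?q ^ 2 *
          ((\<Sum>t\<in>UNIV. G t * \<chi> t) * (\<Sum>s\<in>UNIV. F s * \<chi> s)) * \<chi> x"
      unfolding 1 2 by (simp add: power2_eq_square)
    also have "\<dots> = B1 (-1) / ?q ^ 2 * (\<Sum>t\<in>UNIV. \<Sum>s\<in>UNIV. F s * G t * \<chi> (x * s * t))"
      by (simp add: mult_char_minus_1_squared[OF \<chi>] sum_product sum_distrib_left
          sum_distrib_right mult_char_mult[OF \<chi>] mult_ac)
    finally show ?thesis by (simp add: char_group_simps)
  qed
  then have "greene_2F1 A0 A1 B1 x = ?q / (?q - 1) * (\<Sum>\<chi>\<in>?C.
      B1 (-1) / ?q ^ 2 * (\<Sum>t\<in>UNIV. \<Sum>s\<in>UNIV. F s * G t * \<chi> (x * s * t)))"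
    unfolding greene_2F1_def by simp
  also have "\<dots> = B1 (-1) / (?q * (?q - 1)) *
      (\<Sum>\<chi>\<in>?C. \<Sum>t\<in>UNIV. \<Sum>s\<in>UNIV. F s * G t * \<chi> (x * s * t))"
    using q unfolding sum_distrib_left[symmetric] by (simp add: power2_eq_square)
  also have "(\<Sum>\<chi>\<in>?C. \<Sum>t\<in>UNIV. \<Sum>s\<in>UNIV. F s * G t * \<chi> (x * s * t)) =
      (\<Sum>t\<in>UNIV. \<Sum>s\<in>UNIV. F s * G t * (\<Sum>\<chi>\<in>?C. \<chi> (x * s * t)))"
    by (subst sum.swap, rule sum.cong[OF refl], subst sum.swap)
       (simp add: sum_distrib_left)
  also have "\<dots> = (\<Sum>t\<in>UNIV. G t * cnj (A0 (1 + x * t)) * (?q - 1))"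
  proof (rule sum.cong[OF refl])
    fix t :: 'a
    show "(\<Sum>s\<in>UNIV. F s * G t * (\<Sum>\<chi>\<in>?C. \<chi> (x * s * t))) =
        G t * cnj (A0 (1 + x * t)) * (?q - 1)"
    proof (cases "t = 0")
      case True
      then show ?thesis by (simp add: G_def mult_char_0[OF A1])
    next
      case False
      \<comment> \<open>The only \<open>s\<close> with \<open>x * s * t = 1\<close>, hence the only
        one that survives the sum over all characters.\<close>
      let ?s = "1 / (x * t)"
      have "(\<Sum>s\<in>UNIV. F s * G t * (\<Sum>\<chi>\<in>?C. \<chi> (x * s * t))) =
          (\<Sum>s\<in>{?s}. F s * G t * (\<Sum>\<chi>\<in>?C. \<chi> (x * s * t)))"
      proof (rule sum.mono_neutral_right)
        show "\<forall>s\<in>UNIV - {?s}. F s * G t * (\<Sum>\<chi>\<in>?C. \<chi> (x * s * t)) = 0"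
        proof
          fix s assume "s \<in> UNIV - {?s}"
          then have "x * s * t \<noteq> 1" using x False by (auto simp: field_simps)
          then show "F s * G t * (\<Sum>\<chi>\<in>?C. \<chi> (x * s * t)) = 0"
            using sum_char_group[OF T, of "x * s * t"] x False
            by (cases "s = 0") (auto simp: F_def mult_char_0[OF A0])
        qed
      qed auto
      also have "\<dots> = F ?s * G t * (?q - 1)"
        using sum_char_group[OF T, of 1] x False finite_field_card_gt_1[where 'a = 'a]
        by (simp add: of_nat_diff)
      also have "F ?s = cnj (A0 (1 + x * t))"
      proof -
        have "1 + ?s = (1 + x * t) / (x * t)" using x False by (simp add: field_simps)
        then show ?thesis
          using x False by (simp add: F_def mult_char_divide[OF A0] cnj_mult_char[OF A0]
              mult_char_1[OF A0] mult_char_eq_0_iff[OF A0])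
      qed
      finally show ?thesis by (simp add: mult_ac)
    qed
  qed
  finally show ?thesis
    using q by (simp add: G_def flip: sum_distrib_right)
qed

section \<open>Characters of order 12\<close>

lemma sum_recip_eq_iff:
  fixes u f x :: "'a :: field"
  assumes "u \<noteq> 0"
  shows "u + f / u = x \<longleftrightarrow> u ^ 2 - x * u + f = 0"
proof -
  have "u ^ 2 - x * u + f = u * (u + f / u - x)"
    using assms by (simp add: algebra_simps power2_eq_square)
  then show ?thesis using assms by simp
qed

text \<open>Cardano's identity for \<open>(u + v) ^ 3\<close> with \<open>u * v = m\<close>.\<close>

lemma cube_sum_recip:
  fixes u m :: "'a :: field"
  assumes "u \<noteq> 0"
  shows "u ^ 3 + m ^ 3 / u ^ 3 = (u + m / u) ^ 3 - 3 * m * (u + m / u)"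
proof -
  define v where "v = m / u"
  have m: "m = u * v" using assms by (simp add: v_def)
  have "u ^ 3 + v ^ 3 = (u + v) ^ 3 - 3 * m * (u + v)"
    unfolding m by (simp add: algebra_simps power3_eq_cube)
  then show ?thesis by (simp add: v_def power_divide)
qed

lemma sum_fibres:
  fixes f :: "'a :: finite \<Rightarrow> 'a" and F :: "'a \<Rightarrow> complex"
  shows "(\<Sum>y\<in>UNIV. F (f y)) = (\<Sum>c\<in>UNIV. of_nat (card {y. f y = c}) * F c)"
proof -
  have "(\<Sum>y\<in>UNIV. F (f y)) = (\<Sum>c\<in>UNIV. \<Sum>y\<in>{y \<in> UNIV. f y = c}. F (f y))"
    by (rule sum.group[symmetric]) auto
  also have "\<dots> = (\<Sum>c\<in>UNIV. of_nat (card {y. f y = c}) * F c)"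
    by (rule sum.cong) auto
  finally show ?thesis .
qed

text \<open>What the field computations require of \<open>T\<close> raised to
  \<open>(q - 1) / 12\<close>: its sixth power detects squares and its fourth power detects cubes.
  Since \<open>3 \<noteq> 0\<close>, the element \<open>\<zeta>\<close> is a primitive cube root of
  unity.\<close>

locale order_12_char =
  fixes A :: "'a :: finite_field \<Rightarrow> complex" and \<zeta> :: 'a
  assumes mult_char_A: "mult_char A"
    and A_pow_12: "x \<noteq> 0 \<Longrightarrow> A x ^ 12 = 1"
    and ex_sqrt: "x \<noteq> 0 \<Longrightarrow> A x ^ 6 = 1 \<Longrightarrow> \<exists>y. x = y ^ 2"
    and ex_cbrt: "x \<noteq> 0 \<Longrightarrow> A x ^ 4 = 1 \<Longrightarrow> \<exists>y. x = y ^ 3"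
    and cube_root_unity: "\<zeta> ^ 2 + \<zeta> + 1 = 0"
    and two_neq_0: "(2 :: 'a) \<noteq> 0" and three_neq_0: "(3 :: 'a) \<noteq> 0"
begin

lemmas A_0 = mult_char_0[OF mult_char_A]
  and A_1 = mult_char_1[OF mult_char_A]
  and A_eq_0_iff = mult_char_eq_0_iff[OF mult_char_A]
  and A_mult = mult_char_mult[OF mult_char_A]
  and A_divide = mult_char_divide[OF mult_char_A]
  and A_pow = mult_char_pow[OF mult_char_A]
  and cnj_A = cnj_mult_char[OF mult_char_A]

lemma four_neq_0: "(4 :: 'a) \<noteq> 0"
proof -
  have "(4 :: 'a) = 2 * 2" by simp
  then show ?thesis using two_neq_0 by (metis mult_eq_0_iff)
qed

section \<open>Quadratic and cubic characters and root counts\<close>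

definition qr :: "'a \<Rightarrow> complex" where "qr x = A x ^ 6"

text \<open>A cubic character. Exponent 8 rather than 4 gives \<open>cr z * qr z = A z ^ 2\<close>
  for nonzero \<open>z\<close>, the character that appears in the transformed trace sum.\<close>

definition cr :: "'a \<Rightarrow> complex" where "cr x = A x ^ 8"

lemma qr_0 [simp]: "qr 0 = 0" and cr_0 [simp]: "cr 0 = 0"
  by (simp_all add: qr_def cr_def A_0)

lemma qr_mult: "qr (x * y) = qr x * qr y"
  by (simp add: qr_def A_mult power_mult_distrib)

lemma cr_mult: "cr (x * y) = cr x * cr y"
  by (simp add: cr_def A_mult power_mult_distrib)

lemma qr_squared: "x \<noteq> 0 \<Longrightarrow> qr x ^ 2 = 1"
  using A_pow_12[of x] by (simp add: qr_def flip: power_mult)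

lemma qr_cases: "x \<noteq> 0 \<Longrightarrow> qr x = 1 \<or> qr x = -1"
  using qr_squared[of x] by (simp add: power2_eq_1_iff)

lemma qr_square: "y \<noteq> 0 \<Longrightarrow> qr (y ^ 2) = 1"
  using qr_squared[of y] by (simp add: power2_eq_square qr_mult)

lemma qr_square_mult: "y \<noteq> 0 \<Longrightarrow> qr (y ^ 2 * x) = qr x"
  by (simp add: qr_mult qr_square)

lemma qr_divide: "qr (x / y) = qr x * qr y"
  using qr_square_mult[of y "x / y"] by (cases "y = 0") (simp_all add: power2_eq_square qr_mult mult.commute)

lemma qr_eq_1_imp: "qr x = 1 \<Longrightarrow> \<exists>y. x = y ^ 2"
  using ex_sqrt[of x] by (cases "x = 0") (auto simp: qr_def A_0)

lemma qr_minus_1: "qr (-1) = 1"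
proof -
  have "A (-1) ^ 6 = (A (-1) ^ 2) ^ 3" by (simp flip: power_mult)
  then show ?thesis by (simp add: qr_def mult_char_minus_1_squared[OF mult_char_A])
qed

lemma qr_minus: "qr (- x) = qr x"
  using qr_mult[of "-1" x] by (simp add: qr_minus_1)

lemma card_sqrt: "of_nat (card {y. y ^ 2 = c}) = 1 + qr c"
proof (cases "\<exists>y. c = y ^ 2")
  case True
  then obtain y where y: "c = y ^ 2" by blast
  have S: "{z. z ^ 2 = c} = {y, - y}" by (auto simp: y power2_eq_iff)
  show ?thesis
  proof (cases "y = 0")
    case False
    then have "y \<noteq> - y" using two_neq_0 by (simp add: eq_neg_iff_add_eq_0 flip: mult_2)
    then show ?thesis unfolding S using False by (simp add: y qr_square)
  qed (unfold S, simp add: y)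
next
  case False
  then have "c \<noteq> 0" by (metis zero_power2)
  moreover have "qr c \<noteq> 1" using qr_eq_1_imp False by blast
  moreover have "{z. z ^ 2 = c} = {}" using False by auto
  ultimately show ?thesis using qr_cases[of c] by simp
qed

lemma sum_comp_square: "(\<Sum>y\<in>UNIV. F (y ^ 2)) = (\<Sum>c\<in>UNIV. (1 + qr c) * F c)"
  using sum_fibres[of F "\<lambda>y. y ^ 2"] by (simp add: card_sqrt)

text \<open>The fibres of squaring have sizes \<open>1 + qr c\<close>, and these add up to the size
  of the field.\<close>

lemma sum_qr: "(\<Sum>c\<in>UNIV. qr c) = 0"
  using sum_comp_square[of "\<lambda>_. 1"] by (simp add: sum.distrib)

lemma sum_qr_shift: "(\<Sum>c\<in>UNIV. qr (c + b)) = 0"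
proof -
  have "(\<Sum>c\<in>UNIV. qr (c + b)) = (\<Sum>c\<in>UNIV. qr c)"
    by (rule sum.reindex_bij_witness[of _ "\<lambda>c. c - b" "\<lambda>c. c + b"]) auto
  then show ?thesis by (simp add: sum_qr)
qed

lemma cr_cubed: "x \<noteq> 0 \<Longrightarrow> cr x ^ 3 = 1"
proof -
  assume "x \<noteq> 0"
  have "cr x ^ 3 = (A x ^ 12) ^ 2" by (simp add: cr_def flip: power_mult)
  then show ?thesis using A_pow_12[OF \<open>x \<noteq> 0\<close>] by simp
qed

lemma cr_cube: "x \<noteq> 0 \<Longrightarrow> cr (x ^ 3) = 1"
  using cr_cubed[of x] by (simp add: power3_eq_cube cr_mult)

lemma card_cbrt:
  assumes "z \<noteq> 0"
  shows "of_nat (card {u. u ^ 3 = z}) = 1 + cr z + cr z ^ 2"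
proof (cases "\<exists>u. z = u ^ 3")
  case True
  then obtain u where u: "z = u ^ 3" by blast
  with assms have u0: "u \<noteq> 0" by auto
  have \<zeta>3: "\<zeta> ^ 3 = 1"
  proof -
    have "\<zeta> ^ 3 - 1 = (\<zeta> - 1) * (\<zeta> ^ 2 + \<zeta> + 1)" by (simp add: algebra_simps power3_eq_cube power2_eq_square)
    then show ?thesis by (simp add: cube_root_unity)
  qed
  have \<zeta>1: "\<zeta> \<noteq> 1" using cube_root_unity three_neq_0 by auto
  have \<zeta>0: "\<zeta> \<noteq> 0" using \<zeta>3 by auto
  have \<zeta>2: "\<zeta> ^ 2 \<noteq> 1" "\<zeta> ^ 2 \<noteq> \<zeta>"
    using \<zeta>1 \<zeta>0 \<zeta>3 by (auto simp: power3_eq_cube power2_eq_square)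
  have "{y. y ^ 3 = z} = {u, u * \<zeta>, u * \<zeta> ^ 2}"
  proof -
    have "y ^ 3 - u ^ 3 = (y - u) * (y - u * \<zeta>) * (y - u * \<zeta> ^ 2)" for y
    proof -
      have "(y - u) * (y - u * \<zeta>) * (y - u * \<zeta> ^ 2) =
          y ^ 3 - u ^ 3 * \<zeta> ^ 3 - (\<zeta> ^ 2 + \<zeta> + 1) * (u * y ^ 2 - u ^ 2 * \<zeta> * y)"
        by (simp add: algebra_simps power3_eq_cube power2_eq_square)
      then show ?thesis by (simp add: cube_root_unity \<zeta>3)
    qed
    then have "y ^ 3 = z \<longleftrightarrow> y = u \<or> y = u * \<zeta> \<or> y = u * \<zeta> ^ 2" for y
      by (metis u eq_iff_diff_eq_0 mult_eq_0_iff)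
    then show ?thesis by auto
  qed
  then have "card {y. y ^ 3 = z} = 3" using u0 \<zeta>1 \<zeta>2 by (auto simp: card_insert_if)
  then show ?thesis by (simp add: u cr_cube[OF u0])
next
  case False
  \<comment> \<open>So \<open>cr z\<close> is a nontrivial cube root of unity, and the right-hand
    side vanishes like the root count.\<close>
  have "cr z \<noteq> 1"
  proof
    assume "cr z = 1"
    moreover have "A z ^ 12 = cr z * A z ^ 4" by (simp add: cr_def flip: power_add)
    ultimately have "A z ^ 4 = 1" using A_pow_12[OF assms] by simp
    then show False using ex_cbrt[OF assms] False by blast
  qed
  moreover have "(cr z - 1) * (1 + cr z + cr z ^ 2) = 0"
    using cr_cubed[OF assms] by (simp add: algebra_simps power3_eq_cube power2_eq_square)
  moreover have "{u. u ^ 3 = z} = {}" using False by auto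
  ultimately show ?thesis by simp
qed

lemma cr_inverse:
  assumes "x \<noteq> 0"
  shows "cr (1 / x) = cr x ^ 2"
proof -
  have "cr x * cr (1 / x) = cr (x * (1 / x))" by (simp only: cr_mult)
  also have "\<dots> = 1" using assms by (simp add: cr_def A_1)
  finally have "cr x * cr (1 / x) = 1" .
  also have "\<dots> = cr x * cr x ^ 2"
    using cr_cubed[OF assms] by (simp add: power3_eq_cube power2_eq_square mult.assoc)
  finally have "cr x * cr (1 / x) = cr x * cr x ^ 2" .
  moreover have "cr x \<noteq> 0" using assms by (simp add: cr_def A_eq_0_iff)
  ultimately show ?thesis by simp
qed

text \<open>Counting the nonzero elements by their cubes shows that the sums of \<open>cr\<close>
  and of its square add up to 0. Inversion of \<open>z\<close> exchanges the two sums, so they are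
  equal.\<close>

lemma sum_cr: "(\<Sum>z\<in>UNIV. cr z) = 0"
proof -
  let ?F = "\<lambda>c :: 'a. if c = 0 then 0 else 1 :: complex"
  have "(\<Sum>u\<in>UNIV. ?F (u ^ 3)) = (\<Sum>c\<in>UNIV. of_nat (card {u. u ^ 3 = c}) * ?F c)"
    by (rule sum_fibres)
  also have "\<dots> = (\<Sum>c\<in>UNIV. ?F c + cr c + cr c ^ 2)"
    by (rule sum.cong) (simp_all add: card_cbrt)
  finally have "(\<Sum>z\<in>UNIV. cr z) + (\<Sum>z\<in>UNIV. cr z ^ 2) = 0"
    by (simp add: sum.distrib)
  moreover have "(\<Sum>z\<in>UNIV. cr z ^ 2) = (\<Sum>z\<in>UNIV. cr z)"
  proof (rule sum.reindex_bij_witness[of _ "\<lambda>z. 1 / z" "\<lambda>z. 1 / z"])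
    show "cr (1 / z) = cr z ^ 2" for z
      by (cases "z = 0") (simp_all add: cr_inverse)
  qed auto
  ultimately show ?thesis by simp
qed

text \<open>Clearing the denominator and completing the square matches each \<open>u\<close> with
  the square root \<open>2 * u - x\<close> of the discriminant.\<close>

lemma card_sum_recip:
  assumes "f \<noteq> 0"
  shows "of_nat (card {u. u \<noteq> 0 \<and> u + f / u = x}) = 1 + qr (x ^ 2 - 4 * f)"
proof -
  have eq: "u \<noteq> 0 \<and> u + f / u = x \<longleftrightarrow> (2 * u - x) ^ 2 = x ^ 2 - 4 * f" for u
  proof -
    have "u \<noteq> 0 \<and> u + f / u = x \<longleftrightarrow> u ^ 2 - x * u + f = 0"
      using assms sum_recip_eq_iff[of u f x] by (cases "u = 0") auto
    also have "\<dots> \<longleftrightarrow> 4 * (u ^ 2 - x * u + f) = 0"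
      by (metis four_neq_0 mult_eq_0_iff)
    also have "4 * (u ^ 2 - x * u + f) = (2 * u - x) ^ 2 - (x ^ 2 - 4 * f)"
      by (simp add: algebra_simps power2_eq_square)
    finally show ?thesis by simp
  qed
  have "bij_betw (\<lambda>u. 2 * u - x) {u. u \<noteq> 0 \<and> u + f / u = x} {y. y ^ 2 = x ^ 2 - 4 * f}"
    unfolding eq
  proof (rule bij_betwI[of _ _ _ "\<lambda>y. (y + x) / 2"])
    have half: "2 * ((y + x) / 2) - x = y" for y
      using two_neq_0 by (simp add: add_divide_distrib distrib_left)
    show "(\<lambda>y. (y + x) / 2) \<in> {y. y ^ 2 = x ^ 2 - 4 * f} \<rightarrow> {u. (2 * u - x) ^ 2 = x ^ 2 - 4 * f}"
      unfolding Pi_def mem_Collect_eq half by blast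
    show "2 * ((y + x) / 2) - x = y" for y by (rule half)
  qed (use two_neq_0 in auto)
  then have "card {u. u \<noteq> 0 \<and> u + f / u = x} = card {y. y ^ 2 = x ^ 2 - 4 * f}"
    by (rule bij_betw_same_card)
  then show ?thesis by (simp only: card_sqrt)
qed

subsection \<open>Counting roots of cubics by Cardano's formula\<close>

text \<open>
  A root of \<open>x\<^sup>3 - 3mx = c\<close> is \<open>u + m/u\<close> with \<open>u\<^sup>3\<close> a root of the quadratic resolvent
  \<open>z\<^sup>2 - cz + m\<^sup>3\<close>, whose discriminant is \<open>c\<^sup>2 - 4m\<^sup>3\<close>.
\<close>

definition cubic_roots :: "'a \<Rightarrow> 'a \<Rightarrow> 'a set" where
  "cubic_roots m c = {x. x ^ 3 - 3 * m * x = c}"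

definition resolvent_roots :: "'a \<Rightarrow> 'a \<Rightarrow> 'a set" where
  "resolvent_roots m c = {z. z \<noteq> 0 \<and> z + m ^ 3 / z = c}"

text \<open>The factor \<open>x ^ 2 - 4 * m\<close> is the discriminant of
  \<open>u + m / u = x\<close>. Unless \<open>x ^ 2 = m\<close>, the quadratic character of the
  resolvent discriminant therefore decides whether the root \<open>x\<close> has Cardano's form over
  the base field.\<close>

lemma cubic_disc:
  assumes "x \<in> cubic_roots m c"
  shows "c ^ 2 - 4 * m ^ 3 = (x ^ 2 - m) ^ 2 * (x ^ 2 - 4 * m)"
  using assms unfolding cubic_roots_def
  by (auto simp: algebra_simps power2_eq_square power3_eq_cube)

text \<open>The map taking \<open>z\<close> to \<open>m ^ 3 / z\<close> permutes the resolvent roots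
  and turns \<open>cr\<close> into its square, because \<open>cr (m ^ 3) = 1\<close>.\<close>

lemma sum_resolvent_cr_squared:
  assumes "m \<noteq> 0"
  shows "(\<Sum>z\<in>resolvent_roots m c. cr z ^ 2) = (\<Sum>z\<in>resolvent_roots m c. cr z)"
proof (rule sum.reindex_bij_witness[of _ "\<lambda>z. m ^ 3 / z" "\<lambda>z. m ^ 3 / z"])
  fix z assume "z \<in> resolvent_roots m c"
  then have z: "z \<noteq> 0" "z + m ^ 3 / z = c" by (auto simp: resolvent_roots_def)
  show "m ^ 3 / (m ^ 3 / z) = z" "m ^ 3 / (m ^ 3 / z) = z" using z assms by auto
  show "m ^ 3 / z \<in> resolvent_roots m c" "m ^ 3 / z \<in> resolvent_roots m c"
    using z assms by (auto simp: resolvent_roots_def add.commute)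
  have "cr (m ^ 3 / z) = cr (m ^ 3) * cr (1 / z)" by (simp flip: cr_mult)
  then show "cr (m ^ 3 / z) = cr z ^ 2" by (simp add: cr_cube[OF assms] cr_inverse[OF z(1)])
qed

lemma card_cubic_roots_square_disc:
  assumes m: "m \<noteq> 0" and D: "qr (c ^ 2 - 4 * m ^ 3) = 1"
  shows "of_nat (card (cubic_roots m c)) = 1 + (\<Sum>z\<in>resolvent_roots m c. cr z)"
proof -
  define U where "U = {u. u \<noteq> 0 \<and> u ^ 3 + m ^ 3 / u ^ 3 = c}"
  \<comment> \<open>Count \<open>U\<close> twice, fibring it over the roots \<open>u + m/u\<close> and over the resolvent roots \<open>u\<^sup>3\<close>.\<close>
  have "(\<Sum>x\<in>cubic_roots m c. \<Sum>u | u \<in> U \<and> u + m / u = x. 1) = (\<Sum>u\<in>U. 1 :: complex)"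
  proof (rule sum.group)
    show "(\<lambda>u. u + m / u) ` U \<subseteq> cubic_roots m c"
      by (auto simp: U_def cubic_roots_def cube_sum_recip)
  qed auto
  moreover have "(\<Sum>u | u \<in> U \<and> u + m / u = x. 1) = (2 :: complex)" if x: "x \<in> cubic_roots m c" for x
  proof -
    \<comment> \<open>Otherwise the discriminant would be 0. Thus \<open>x ^ 2 - 4 * m\<close> is a
      nonzero square and \<open>x\<close> comes from exactly two \<open>u\<close>.\<close>
    have "x ^ 2 \<noteq> m" using D cubic_disc[OF x] by auto
    then have "qr (x ^ 2 - 4 * m) = 1"
      using D cubic_disc[OF x] by (simp add: qr_square_mult)
    moreover have "{u. u \<in> U \<and> u + m / u = x} = {u. u \<noteq> 0 \<and> u + m / u = x}"
      using x by (auto simp: U_def cubic_roots_def cube_sum_recip)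
    ultimately show ?thesis using card_sum_recip[OF m, of x] by simp
  qed
  ultimately have 1: "of_nat (card (cubic_roots m c)) * 2 = (of_nat (card U) :: complex)"
    by simp
  have "(\<Sum>z\<in>resolvent_roots m c. \<Sum>u | u \<in> U \<and> u ^ 3 = z. 1) = (\<Sum>u\<in>U. 1 :: complex)"
    by (rule sum.group) (auto simp: U_def resolvent_roots_def)
  moreover have "(\<Sum>u | u \<in> U \<and> u ^ 3 = z. 1) = 1 + cr z + cr z ^ 2"
    if z: "z \<in> resolvent_roots m c" for z
  proof -
    have "{u. u \<in> U \<and> u ^ 3 = z} = {u. u ^ 3 = z}"
      using z by (auto simp: U_def resolvent_roots_def)
    then show ?thesis using card_cbrt[of z] z by (simp add: resolvent_roots_def)
  qed
  ultimately have "of_nat (card U) = (\<Sum>z\<in>resolvent_roots m c. 1 + cr z + cr z ^ 2)"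
    by simp
  also have "\<dots> = of_nat (card (resolvent_roots m c)) + 2 * (\<Sum>z\<in>resolvent_roots m c. cr z)"
    by (simp add: sum.distrib sum_resolvent_cr_squared[OF m])
  also have "of_nat (card (resolvent_roots m c)) = (2 :: complex)"
    using card_sum_recip[of "m ^ 3" c] m D by (simp add: resolvent_roots_def)
  finally have "of_nat (card (cubic_roots m c)) * 2 = (1 + (\<Sum>z\<in>resolvent_roots m c. cr z)) * 2"
    using 1 by simp
  then show ?thesis
    by (rule mult_right_cancel[THEN iffD1, rotated]) (rule zero_neq_numeral[symmetric])
qed

lemma card_cubic_roots_zero_disc:
  assumes m: "m \<noteq> 0" and D: "c ^ 2 = 4 * m ^ 3"
  shows "of_nat (card (cubic_roots m c)) = 1 + (\<Sum>z\<in>resolvent_roots m c. cr z)"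
proof -
  \<comment> \<open>The double root is \<open>- k\<close>: the cubic becomes
    \<open>(x - 2 * k) * (x + k) ^ 2\<close> and the resolvent \<open>(z - k ^ 3) ^ 2\<close>. Both
    sides of the claim are then 2.\<close>
  define k where "k = c / (2 * m)"
  have mk: "m = k ^ 2"
  proof -
    have "k ^ 2 = 4 * m ^ 3 / (4 * m ^ 2)"
      by (simp add: k_def power_divide power_mult_distrib D)
    then show ?thesis using m four_neq_0 by (simp add: power2_eq_square power3_eq_cube)
  qed
  have ck: "c = 2 * k ^ 3"
  proof -
    have "c = 2 * m * k" using m two_neq_0 by (simp add: k_def)
    then show ?thesis by (simp add: mk power2_eq_square power3_eq_cube)
  qed
  have k: "k \<noteq> 0" using m mk by auto
  have "x \<in> cubic_roots m c \<longleftrightarrow> x = 2 * k \<or> x = - k" for x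
  proof -
    have "x \<in> cubic_roots m c \<longleftrightarrow> x ^ 3 - 3 * m * x - c = 0"
      by (simp add: cubic_roots_def)
    also have "x ^ 3 - 3 * m * x - c = (x - 2 * k) * (x + k) ^ 2"
      by (simp add: mk ck algebra_simps power2_eq_square power3_eq_cube)
    finally show ?thesis by (simp add: eq_neg_iff_add_eq_0)
  qed
  then have "cubic_roots m c = {2 * k, - k}" by auto
  moreover have "2 * k \<noteq> - k"
  proof
    assume "2 * k = - k"
    then have "3 * k = 0" by (simp add: eq_neg_iff_add_eq_0)
    then show False using k three_neq_0 by simp
  qed
  ultimately have "card (cubic_roots m c) = 2" by simp
  moreover have "resolvent_roots m c = {k ^ 3}"
  proof -
    have "z \<noteq> 0 \<and> z + m ^ 3 / z = c \<longleftrightarrow> (z - k ^ 3) ^ 2 = 0" for z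
    proof (cases "z = 0")
      case False
      have "z ^ 2 - c * z + m ^ 3 = (z - k ^ 3) ^ 2"
        by (simp add: mk ck algebra_simps power2_eq_square power3_eq_cube)
      then show ?thesis using False by (simp add: sum_recip_eq_iff)
    qed (use k in auto)
    then show ?thesis by (auto simp: resolvent_roots_def)
  qed
  ultimately show ?thesis by (simp add: cr_cube[OF k])
qed

text \<open>Given a root \<open>x\<close>, any other root solves a quadratic of discriminant
  \<open>-3 * (x ^ 2 - 4 * m)\<close>. Here -3 is a square because the field contains
  \<open>\<zeta>\<close>, while \<open>x ^ 2 - 4 * m\<close> is a nonsquare by
  \<open>cubic_disc\<close>.\<close>

lemma cubic_roots_nonsquare_disc:
  assumes m: "m \<noteq> 0" and D: "qr (c ^ 2 - 4 * m ^ 3) = -1"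
  shows "card (cubic_roots m c) \<le> 1" and "resolvent_roots m c = {}"
proof -
  show "resolvent_roots m c = {}"
    using card_sum_recip[of "m ^ 3" c] m D by (simp add: resolvent_roots_def)
  have "x = y" if x: "x \<in> cubic_roots m c" and y: "y \<in> cubic_roots m c" for x y
  proof (rule ccontr)
    assume "x \<noteq> y"
    have "(y - x) * (y ^ 2 + x * y + x ^ 2 - 3 * m) = (y ^ 3 - 3 * m * y) - (x ^ 3 - 3 * m * x)"
      by (simp add: algebra_simps power2_eq_square power3_eq_cube)
    also have "\<dots> = 0" using x y by (simp add: cubic_roots_def)
    finally have "y ^ 2 + x * y + x ^ 2 - 3 * m = 0" using \<open>x \<noteq> y\<close> by simp
    \<comment> \<open>The element \<open>2 * \<zeta> + 1\<close> is a square root of -3.\<close>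
    moreover have "(2 * y + x) ^ 2 - (2 * \<zeta> + 1) ^ 2 * (x ^ 2 - 4 * m) =
        4 * (y ^ 2 + x * y + x ^ 2 - 3 * m) - 4 * (\<zeta> ^ 2 + \<zeta> + 1) * (x ^ 2 - 4 * m)"
      by (simp add: algebra_simps power2_eq_square)
    ultimately have sq: "(2 * y + x) ^ 2 = (2 * \<zeta> + 1) ^ 2 * (x ^ 2 - 4 * m)"
      by (simp add: cube_root_unity)
    have "(2 * \<zeta> + 1) ^ 2 = 4 * (\<zeta> ^ 2 + \<zeta> + 1) - 3"
      by (simp add: algebra_simps power2_eq_square)
    then have "2 * \<zeta> + 1 \<noteq> 0" using three_neq_0 by (auto simp: cube_root_unity)
    then have "qr (x ^ 2 - 4 * m) = qr ((2 * y + x) ^ 2)" by (simp add: sq qr_square_mult)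
    moreover have "x ^ 2 \<noteq> m" using D cubic_disc[OF x] by auto
    then have "qr (x ^ 2 - 4 * m) = -1"
      using D cubic_disc[OF x] by (simp add: qr_square_mult)
    ultimately show False using qr_square[of "2 * y + x"] by (cases "2 * y + x = 0") auto
  qed
  then show "card (cubic_roots m c) \<le> 1"
    by (simp add: card_le_Suc0_iff_eq)
qed

lemma card_cubic_roots:
  assumes m: "m \<noteq> 0"
  shows "of_nat (card (cubic_roots m c)) = 1 + (\<Sum>z\<in>resolvent_roots m c. cr z)"
proof -
  \<comment> \<open>For a nonsquare discriminant only an upper bound of one root is known. The defect \<open>\<delta> \<ge> 0\<close> vanishes
    because the root counts sum to \<open>q\<close> over all \<open>c\<close>.\<close>
  define \<delta> where "\<delta> c = (if qr (c ^ 2 - 4 * m ^ 3) = -1 then 1 - card (cubic_roots m c) else 0)" for c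
  have \<delta>: "of_nat (card (cubic_roots m c)) + of_nat (\<delta> c) = 1 + (\<Sum>z\<in>resolvent_roots m c. cr z)" for c
  proof -
    consider "c ^ 2 - 4 * m ^ 3 = 0" | "qr (c ^ 2 - 4 * m ^ 3) = 1" | "qr (c ^ 2 - 4 * m ^ 3) = -1"
      using qr_cases by blast
    then show ?thesis
    proof cases
      case 1
      then show ?thesis using card_cubic_roots_zero_disc[OF m] by (simp add: \<delta>_def)
    next
      case 2
      then show ?thesis using card_cubic_roots_square_disc[OF m] by (simp add: \<delta>_def)
    next
      case 3
      then show ?thesis
        using cubic_roots_nonsquare_disc[OF m 3] by (simp add: \<delta>_def of_nat_diff)
    qed
  qed
  \<comment> \<open>Each nonzero \<open>z\<close> is a resolvent root for exactly one
    \<open>c\<close>, so the total is the complete sum of \<open>cr\<close>.\<close>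
  have "(\<Sum>c\<in>UNIV. \<Sum>z\<in>resolvent_roots m c. cr z) =
      (\<Sum>c\<in>UNIV. \<Sum>z | z \<in> UNIV - {0} \<and> z + m ^ 3 / z = c. cr z)"
    by (simp add: resolvent_roots_def)
  also have "\<dots> = (\<Sum>z\<in>UNIV - {0}. cr z)"
    by (rule sum.group) auto
  also have "\<dots> = (\<Sum>z\<in>UNIV. cr z)"
    by (rule sum.mono_neutral_left) auto
  finally have W: "(\<Sum>c\<in>UNIV. \<Sum>z\<in>resolvent_roots m c. cr z) = 0"
    by (simp add: sum_cr)
  have N: "(\<Sum>c\<in>UNIV. of_nat (card (cubic_roots m c))) = (of_nat (CARD('a)) :: complex)"
    using sum_fibres[of "\<lambda>_. 1" "\<lambda>x. x ^ 3 - 3 * m * x"] by (simp add: cubic_roots_def)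
  have "(\<Sum>c\<in>UNIV. of_nat (card (cubic_roots m c)) + of_nat (\<delta> c)) =
      (\<Sum>c\<in>UNIV. 1 + (\<Sum>z\<in>resolvent_roots m c. cr z))"
    by (simp only: \<delta>)
  then have "of_nat (\<Sum>c\<in>UNIV. \<delta> c) = (0 :: complex)"
    by (simp add: sum.distrib W N)
  then have "(\<Sum>c\<in>UNIV. \<delta> c) = 0" by (simp only: of_nat_eq_0_iff)
  then have "\<delta> c = 0" by simp
  then show ?thesis using \<delta>[of c] by simp
qed

text \<open>Group the left side by the value \<open>c\<close> of \<open>x ^ 3 - 3 * m * x\<close>
  and insert the root count. Its constant term contributes a complete sum of \<open>qr\<close>,
  which is 0; the rest is regrouped by \<open>z\<close> with \<open>c = z + m ^ 3 / z\<close>.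
  Clearing this denominator turns \<open>cr z\<close> into \<open>A z ^ 2\<close>.\<close>

lemma sum_qr_cubic:
  assumes m: "m \<noteq> 0"
  shows "(\<Sum>x\<in>UNIV. qr (x ^ 3 - 3 * m * x + b)) = (\<Sum>z\<in>UNIV. A z ^ 2 * qr (z ^ 2 + b * z + m ^ 3))"
proof -
  have "(\<Sum>x\<in>UNIV. qr (x ^ 3 - 3 * m * x + b)) =
      (\<Sum>c\<in>UNIV. of_nat (card (cubic_roots m c)) * qr (c + b))"
    unfolding cubic_roots_def by (rule sum_fibres)
  also have "\<dots> = (\<Sum>c\<in>UNIV. qr (c + b)) +
      (\<Sum>c\<in>UNIV. \<Sum>z\<in>resolvent_roots m c. cr z * qr (c + b))"
    by (simp add: card_cubic_roots[OF m] ring_distribs sum.distrib sum_distrib_right)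
  also have "\<dots> = (\<Sum>c\<in>UNIV. \<Sum>z | z \<in> UNIV - {0} \<and> z + m ^ 3 / z = c. cr z * qr (z + m ^ 3 / z + b))"
    by (simp add: sum_qr_shift resolvent_roots_def)
  also have "\<dots> = (\<Sum>z\<in>UNIV - {0}. cr z * qr (z + m ^ 3 / z + b))"
    by (rule sum.group) auto
  also have "\<dots> = (\<Sum>z\<in>UNIV - {0}. A z ^ 2 * qr (z ^ 2 + b * z + m ^ 3))"
  proof (rule sum.cong[OF refl])
    fix z :: 'a assume "z \<in> UNIV - {0}"
    then have z: "z \<noteq> 0" by simp
    then have "z + m ^ 3 / z + b = (z ^ 2 + b * z + m ^ 3) / z"
      by (simp add: field_simps power2_eq_square)
    then have "qr (z + m ^ 3 / z + b) = qr (z ^ 2 + b * z + m ^ 3) * A z ^ 6"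
      by (simp add: qr_divide) (simp add: qr_def)
    moreover have "cr z * A z ^ 6 = A z ^ 12 * A z ^ 2" by (simp add: cr_def flip: power_add)
    ultimately show "cr z * qr (z + m ^ 3 / z + b) = A z ^ 2 * qr (z ^ 2 + b * z + m ^ 3)"
      by (simp add: A_pow_12[OF z] mult_ac)
  qed
  also have "\<dots> = (\<Sum>z\<in>UNIV. A z ^ 2 * qr (z ^ 2 + b * z + m ^ 3))"
    by (rule sum.mono_neutral_left) (auto simp: A_0)
  finally show ?thesis .
qed

subsection \<open>A quadratic transformation\<close>

text \<open>If \<open>t\<close> is a root, the other one is \<open>e ^ 2 / t\<close> and has the
  same character, while \<open>p + 2 * e\<close> and \<open>p - 2 * e\<close> equal
  \<open>(t + e) ^ 2 / t\<close> and \<open>(t - e) ^ 2 / t\<close>. A double root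
  \<open>t = e\<close> or \<open>t = - e\<close> makes exactly one term on the right vanish. Without
  roots, the product of the two terms is -1, so they cancel.\<close>

lemma sum_qr_roots_square:
  assumes e: "e \<noteq> 0"
  shows "(\<Sum>t | t ^ 2 - p * t + e ^ 2 = 0. qr t) = qr (p + 2 * e) + qr (p - 2 * e)"
proof (cases "\<exists>t. t ^ 2 - p * t + e ^ 2 = 0")
  case True
  then obtain t where t: "t ^ 2 - p * t + e ^ 2 = 0" by blast
  have t0: "t \<noteq> 0" using t e by auto
  have p: "p = t + e ^ 2 / t" using sum_recip_eq_iff[OF t0, of "e ^ 2" p] t by simp
  have plus: "qr (p + 2 * e) = (if t = - e then 0 else qr t)"
  proof -
    have "p + 2 * e = (t + e) ^ 2 / t" using t0 by (simp add: p field_simps power2_eq_square)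
    then show ?thesis using qr_square[of "t + e"]
      by (auto simp: qr_divide eq_neg_iff_add_eq_0)
  qed
  have minus: "qr (p - 2 * e) = (if t = e then 0 else qr t)"
  proof -
    have "p - 2 * e = (t - e) ^ 2 / t" using t0 by (simp add: p field_simps power2_eq_square)
    then show ?thesis using qr_square[of "t - e"] by (auto simp: qr_divide)
  qed
  have "s ^ 2 - p * s + e ^ 2 = (s - t) * (s - e ^ 2 / t)" for s
    using t0 by (simp add: p field_simps power2_eq_square)
  then have roots: "{s. s ^ 2 - p * s + e ^ 2 = 0} = {t, e ^ 2 / t}" by auto
  have "e \<noteq> - e" using e two_neq_0 by (simp add: eq_neg_iff_add_eq_0 flip: mult_2)
  moreover have "e ^ 2 / t = t \<longleftrightarrow> t = e \<or> t = - e"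
    using t0 by (auto simp: divide_eq_eq power2_eq_iff simp flip: power2_eq_square)
  moreover have "qr (e ^ 2 / t) = qr t" using qr_square[OF e] by (simp add: qr_divide)
  ultimately show ?thesis unfolding roots plus minus by (cases "t = e \<or> t = - e") auto
next
  case False
  then have no_roots: "{u. u \<noteq> 0 \<and> u + e ^ 2 / u = p} = {}"
    using sum_recip_eq_iff[of _ "e ^ 2" p] by auto
  have "1 + qr (p ^ 2 - 4 * e ^ 2) = 0"
    using card_sum_recip[of "e ^ 2" p] e unfolding no_roots by simp
  then have "qr (p ^ 2 - 4 * e ^ 2) = -1"
    by (simp add: add_eq_0_iff)
  also have "p ^ 2 - 4 * e ^ 2 = (p + 2 * e) * (p - 2 * e)"
    by (simp add: algebra_simps power2_eq_square)
  finally have "qr (p + 2 * e) * qr (p - 2 * e) = -1" by (simp add: qr_mult)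
  moreover from this have "p + 2 * e \<noteq> 0" "p - 2 * e \<noteq> 0" by auto
  ultimately have "qr (p + 2 * e) + qr (p - 2 * e) = 0"
    using qr_cases[of "p + 2 * e"] qr_cases[of "p - 2 * e"] by auto
  then show ?thesis using False by simp
qed

text \<open>The roots have product \<open>f\<close>, so exchanging \<open>t\<close> with
  \<open>f / t\<close> changes the sign of the sum.\<close>

lemma sum_qr_roots_nonsquare:
  assumes f: "qr f = -1"
  shows "(\<Sum>t | t ^ 2 - p * t + f = 0. qr t) = 0"
proof -
  let ?S = "{t. t ^ 2 - p * t + f = 0}"
  have f0: "f \<noteq> 0" using f by auto
  have S: "t \<noteq> 0 \<and> t + f / t = p" if "t \<in> ?S" for t
    using that f0 sum_recip_eq_iff[of t f p] by (cases "t = 0") auto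
  have S': "f / t \<in> ?S" if "t \<in> ?S" for t
    using S[OF that] f0 sum_recip_eq_iff[of "f / t" f p] by (auto simp: add.commute)
  have "(\<Sum>t\<in>?S. qr t) = (\<Sum>t\<in>?S. qr (f / t))"
  proof (rule sum.reindex_bij_witness[of _ "\<lambda>t. f / t" "\<lambda>t. f / t"])
    fix t assume t: "t \<in> ?S"
    show "f / t \<in> ?S" "f / t \<in> ?S" by (fact S'[OF t])+
    show "f / (f / t) = t" "f / (f / t) = t" using S[OF t] f0 by auto
    then show "qr (f / (f / t)) = qr t" by simp
  qed
  also have "\<dots> = - (\<Sum>t\<in>?S. qr t)"
    by (simp add: qr_divide f sum_negf)
  finally show ?thesis by simp
qed

lemma hypergeometric_sum_eq:
  assumes x: "x \<noteq> 0" "x \<noteq> 1"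
  shows "(\<Sum>t\<in>UNIV. A t ^ 5 * A (1 + t) * cnj (A (1 + x * t))) =
         A (-1) / A x * (\<Sum>m\<in>UNIV. A m ^ 2 * qr (m ^ 2 / x + 2 * m + 1))"
proof -
  \<comment> \<open>The summand is \<open>A (w t) * qr t\<close>. On a fibre \<open>w t = c\<close> the two values of \<open>t\<close> are the roots of a
    quadratic with constant term \<open>-1/(cx)\<close>, so only \<open>c = n\<^sup>2/x\<close> contributes.\<close>
  define w where "w t = (1 + t) / (t * (1 + x * t))" for t
  define V where "V c = (\<Sum>t | w t = c. qr t)" for c
  \<comment> \<open>A square root of -1 writes the constant term \<open>- (1 / n ^ 2)\<close> of the
    fibre quadratic as the square \<open>(i / n) ^ 2\<close>.\<close>
  obtain i :: 'a where i: "i ^ 2 = -1"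
    using qr_eq_1_imp[OF qr_minus_1] by metis
  then have i0: "i \<noteq> 0" by auto
  define h where "h n = qr (1 - n ^ 2 / x + 2 * i * n)" for n
  have fibre: "{t. w t = c} = {t. t ^ 2 - (1 - c) / (c * x) * t + - (1 / (c * x)) = 0}"
    if c: "c \<noteq> 0" for c
  proof -
    have "w t = c \<longleftrightarrow> t ^ 2 - (1 - c) / (c * x) * t + - (1 / (c * x)) = 0" for t
    proof -
      have eq: "c * x * (t ^ 2 - (1 - c) / (c * x) * t + - (1 / (c * x))) = c * (t * (1 + x * t)) - (1 + t)"
        using c x by (simp add: field_simps power2_eq_square)
      have "w t = c \<longleftrightarrow> 1 + t = c * (t * (1 + x * t))"
      proof (cases "t * (1 + x * t) = 0")
        case True
        \<comment> \<open>Division by zero gives \<open>w t = 0\<close> here, which differs from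
          \<open>c\<close>. The polynomial equation must fail as well: \<open>t = -1\<close> would
          force \<open>x = 1\<close>.\<close>
        have "1 + t \<noteq> 0"
        proof
          assume "1 + t = 0"
          then have "t = -1" by (simp add: add_eq_0_iff)
          then show False using True x by simp
        qed
        then show ?thesis using c unfolding w_def True by simp
      qed (simp add: w_def divide_eq_eq)
      also have "\<dots> \<longleftrightarrow> c * x * (t ^ 2 - (1 - c) / (c * x) * t + - (1 / (c * x))) = 0"
        unfolding eq by auto
      finally show ?thesis using c x by simp
    qed
    then show ?thesis by auto
  qed
  have V_square: "V (n ^ 2 / x) = h n + h (- n)" if n: "n \<noteq> 0" for n
  proof -
    let ?c = "n ^ 2 / x" and ?p = "(1 - n ^ 2 / x) / n ^ 2"
    have c: "?c \<noteq> 0" "?c * x = n ^ 2" using n x by simp_all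
    have "- (1 / n ^ 2) = (i / n) ^ 2" by (simp add: power_divide i)
    then have "V ?c = (\<Sum>t | t ^ 2 - ?p * t + (i / n) ^ 2 = 0. qr t)"
      unfolding V_def fibre[OF c(1)] c(2) by simp
    also have "\<dots> = qr (?p + 2 * (i / n)) + qr (?p - 2 * (i / n))"
      using n i0 by (intro sum_qr_roots_square) simp
    also have "?p + 2 * (i / n) = (1 - n ^ 2 / x + 2 * i * n) / n ^ 2"
      using n by (simp add: add_divide_distrib power2_eq_square)
    also have "?p - 2 * (i / n) = (1 - n ^ 2 / x + 2 * i * (- n)) / n ^ 2"
      using n by (simp add: add_divide_distrib diff_divide_distrib power2_eq_square)
    finally show ?thesis
      using n by (simp add: qr_divide qr_square h_def)
  qed
  have V_nonsquare: "V (y / x) = 0" if y: "qr y = -1" for y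
  proof -
    have "y \<noteq> 0" using y by auto
    then have "V (y / x) = (\<Sum>t | t ^ 2 - (1 - y / x) / y * t + - (1 / y) = 0. qr t)"
      unfolding V_def using x fibre[of "y / x"] by simp
    also have "qr (- (1 / y)) = -1" using y qr_square[of 1] by (simp add: qr_minus qr_divide)
    then have "(\<Sum>t | t ^ 2 - (1 - y / x) / y * t + - (1 / y) = 0. qr t) = 0"
      by (rule sum_qr_roots_nonsquare)
    finally show ?thesis .
  qed
  \<comment> \<open>Write \<open>A t ^ 5\<close> as \<open>A t ^ 6\<close> divided by
    \<open>A t\<close>; at \<open>t = 0\<close> both sides vanish.\<close>
  have "A t ^ 5 * A (1 + t) * cnj (A (1 + x * t)) = A (w t) * qr t" for t
  proof (cases "t = 0")
    case False
    then have "A t \<noteq> 0" by (simp add: A_eq_0_iff)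
    moreover have "A (w t) = A (1 + t) / (A t * A (1 + x * t))"
      by (simp only: w_def A_divide A_mult)
    moreover have "u ^ 5 * v * inverse z = v / (u * z) * u ^ 6" if "u \<noteq> 0" for u v z :: complex
      using that by (cases "z = 0") (simp_all add: field_simps eval_nat_numeral)
    ultimately show ?thesis
      by (simp only: qr_def cnj_A not_False_eq_True)
  qed (simp add: A_0)
  then have "(\<Sum>t\<in>UNIV. A t ^ 5 * A (1 + t) * cnj (A (1 + x * t))) =
      (\<Sum>t\<in>UNIV. A (w t) * qr t)"
    by simp
  also have "\<dots> = (\<Sum>c\<in>UNIV. \<Sum>t | t \<in> UNIV \<and> w t = c. A (w t) * qr t)"
    by (rule sum.group[symmetric]) auto
  also have "\<dots> = (\<Sum>c\<in>UNIV. A c * V c)"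
    by (simp add: V_def sum_distrib_left)
  also have "\<dots> = (\<Sum>y\<in>UNIV. A (y / x) * V (y / x))"
    by (rule sum.reindex_bij_witness[of _ "\<lambda>y. y / x" "\<lambda>c. c * x"]) (use x in auto)
  finally have S: "(\<Sum>t\<in>UNIV. A t ^ 5 * A (1 + t) * cnj (A (1 + x * t))) =
      (\<Sum>y\<in>UNIV. A (y / x) * V (y / x))" .
  \<comment> \<open>Nonsquares and 0 contribute nothing, so the weight 2 may be replaced by
    \<open>1 + qr y\<close>, which turns the sum into one over \<open>y = n ^ 2\<close>. The halves
    with \<open>h n\<close> and \<open>h (- n)\<close> agree, which removes the 2 again.\<close>
  have "2 * (\<Sum>y\<in>UNIV. A (y / x) * V (y / x)) = (\<Sum>y\<in>UNIV. (1 + qr y) * (A (y / x) * V (y / x)))"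
    unfolding sum_distrib_left
  proof (rule sum.cong[OF refl])
    fix y :: 'a
    show "2 * (A (y / x) * V (y / x)) = (1 + qr y) * (A (y / x) * V (y / x))"
      using qr_cases[of y] V_nonsquare[of y] by (cases "y = 0") (auto simp: A_0)
  qed
  also have "\<dots> = (\<Sum>n\<in>UNIV. A (n ^ 2 / x) * V (n ^ 2 / x))"
    by (rule sum_comp_square[symmetric])
  also have "\<dots> = (\<Sum>n\<in>UNIV. A (n ^ 2 / x) * h n + A (n ^ 2 / x) * h (- n))"
  proof (rule sum.cong[OF refl])
    fix n :: 'a
    show "A (n ^ 2 / x) * V (n ^ 2 / x) = A (n ^ 2 / x) * h n + A (n ^ 2 / x) * h (- n)"
      by (cases "n = 0") (simp_all add: A_0 V_square distrib_left)
  qed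
  also have "\<dots> = (\<Sum>n\<in>UNIV. A (n ^ 2 / x) * h n) + (\<Sum>n\<in>UNIV. A (n ^ 2 / x) * h (- n))"
    by (rule sum.distrib)
  also have "(\<Sum>n\<in>UNIV. A (n ^ 2 / x) * h (- n)) = (\<Sum>n\<in>UNIV. A (n ^ 2 / x) * h n)"
    by (rule sum.reindex_bij_witness[of _ uminus uminus]) auto
  finally have "(\<Sum>y\<in>UNIV. A (y / x) * V (y / x)) = (\<Sum>n\<in>UNIV. A (n ^ 2 / x) * h n)"
    by simp
  also have "\<dots> = (\<Sum>m\<in>UNIV. A (-1) / A x * (A m ^ 2 * qr (m ^ 2 / x + 2 * m + 1)))"
  \<comment> \<open>Setting \<open>m = i * n\<close> replaces \<open>n ^ 2\<close> by
    \<open>- (m ^ 2)\<close>; this removes \<open>i\<close> from \<open>h\<close> and produces the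
    factor \<open>A (-1)\<close>.\<close>
  proof (rule sum.reindex_bij_witness[of _ "\<lambda>m. - i * m" "\<lambda>n. i * n"])
    fix n :: 'a
    have ii: "i * (i * y) = - y" for y
      using i by (simp add: power2_eq_square flip: mult.assoc)
    show "- i * (i * n) = n" "i * (- i * n) = n" by (simp_all add: ii)
    have "n ^ 2 = (-1) * (i * n) ^ 2" by (simp add: power_mult_distrib i)
    then have "A (n ^ 2 / x) = A (-1) / A x * A (i * n) ^ 2"
      by (simp only: A_mult A_divide A_pow zero_less_numeral) simp
    moreover have "h n = qr ((i * n) ^ 2 / x + 2 * (i * n) + 1)"
      by (simp add: h_def power_mult_distrib i algebra_simps)
    ultimately show "A (-1) / A x * (A (i * n) ^ 2 * qr ((i * n) ^ 2 / x + 2 * (i * n) + 1)) =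
        A (n ^ 2 / x) * h n"
      by simp
  qed auto
  finally show ?thesis unfolding S sum_distrib_left .
qed

section \<open>Matching the cubic sum with the hypergeometric sum\<close>

lemma sum_qr_cubic_eq_hypergeometric_sum:
  assumes m: "m \<noteq> 0" and b: "b \<noteq> 0" and disc: "b ^ 2 \<noteq> 4 * m ^ 3"
    and x: "x = b ^ 2 / (4 * m ^ 3)"
  shows "(\<Sum>X\<in>UNIV. qr (X ^ 3 - 3 * m * X + b)) =
    A (- (m ^ 3)) ^ 3 * (\<Sum>t\<in>UNIV. A t ^ 5 * A (1 + t) * cnj (A (1 + x * t)))"
proof -
  define d where "d = m ^ 3"
  have d: "d \<noteq> 0" "x = b ^ 2 / (4 * d)" using m x by (simp_all add: d_def)
  have x0: "x \<noteq> 0" "x \<noteq> 1" using b d disc four_neq_0 by (auto simp: d_def)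
  \<comment> \<open>With \<open>z = r * k\<close>, the linear term is \<open>2 * d * k\<close> and
    the quadratic term \<open>d * k ^ 2 / x\<close>, so \<open>d\<close> factors out and the
    quadratic of \<open>hypergeometric_sum_eq\<close> remains.\<close>
  define r where "r = 2 * d / b"
  have r: "r \<noteq> 0" "b * r = 2 * d" "r ^ 2 = d / x"
    using b d two_neq_0 four_neq_0
    by (simp_all add: r_def power_divide power_mult_distrib power2_eq_square)
  have "(\<Sum>X\<in>UNIV. qr (X ^ 3 - 3 * m * X + b)) = (\<Sum>z\<in>UNIV. A z ^ 2 * qr (z ^ 2 + b * z + d))"
    unfolding d_def by (rule sum_qr_cubic[OF m])
  also have "\<dots> = (\<Sum>k\<in>UNIV. A (r * k) ^ 2 * qr ((r * k) ^ 2 + b * (r * k) + d))"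
    by (rule sum.reindex_bij_witness[of _ "\<lambda>k. r * k" "\<lambda>z. z / r"]) (use r(1) in auto)
  also have "\<dots> = (\<Sum>k\<in>UNIV. A d ^ 7 / A x * (A k ^ 2 * qr (k ^ 2 / x + 2 * k + 1)))"
  proof (rule sum.cong[OF refl])
    fix k :: 'a
    have "A (r * k) ^ 2 = A (r ^ 2) * A k ^ 2"
      by (simp only: A_mult A_pow zero_less_numeral power_mult_distrib)
    then have "A (r * k) ^ 2 = A d / A x * A k ^ 2"
      by (simp only: r(3) A_divide)
    moreover have "(r * k) ^ 2 + b * (r * k) + d = d * (k ^ 2 / x + 2 * k + 1)"
    proof -
      have "b * (r * k) = 2 * d * k" by (simp only: r(2) flip: mult.assoc)
      then show ?thesis unfolding power_mult_distrib r(3) by (simp add: algebra_simps)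
    qed
    then have "qr ((r * k) ^ 2 + b * (r * k) + d) = A d ^ 6 * qr (k ^ 2 / x + 2 * k + 1)"
      by (simp only: qr_mult) (simp add: qr_def)
    ultimately show "A (r * k) ^ 2 * qr ((r * k) ^ 2 + b * (r * k) + d) =
        A d ^ 7 / A x * (A k ^ 2 * qr (k ^ 2 / x + 2 * k + 1))"
      by (simp add: eval_nat_numeral)
  qed
  also have "\<dots> = A d ^ 7 / A x * (\<Sum>k\<in>UNIV. A k ^ 2 * qr (k ^ 2 / x + 2 * k + 1))"
    by (simp only: sum_distrib_left)
  also have "A d ^ 7 / A x = A (- d) ^ 3 * (A (-1) / A x)"
  proof -
    \<comment> \<open>As \<open>d\<close> is a cube, \<open>A d ^ 7\<close> reduces to
      \<open>A d ^ 3\<close>. The signs agree because \<open>A (-1) ^ 4 = 1\<close>.\<close>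
    have "A d ^ 4 = A m ^ 12" by (simp add: d_def A_pow flip: power_mult)
    then have "A d ^ 4 = 1" using A_pow_12[OF m] by simp
    then have "A d ^ 7 = A d ^ 3" using power_add[of "A d" 4 3] by simp
    moreover have "A (- d) = A (-1) * A d" using A_mult[of "-1" d] by simp
    moreover have "A (-1) ^ 3 * A (-1) = 1"
    proof -
      have "A (-1) ^ 3 * A (-1) = (A (-1) ^ 2) ^ 2" by (simp add: eval_nat_numeral)
      then show ?thesis by (simp add: mult_char_minus_1_squared[OF mult_char_A])
    qed
    ultimately show ?thesis by (simp add: power_mult_distrib mult_ac)
  qed
  finally show ?thesis
    unfolding hypergeometric_sum_eq[OF x0] d_def by (simp only: mult.assoc)
qed

end

section \<open>The trace of Frobenius\<close>

text \<open>On the curve, \<open>Z = 0\<close> forces \<open>X = 0\<close> and leaves the single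
  point at infinity. Every other class has exactly one representative with
  \<open>Z = 1\<close>.\<close>

lemma card_ell_points:
  fixes a b :: "'a :: finite_field"
  shows "card (ell_points a b) = 1 + (\<Sum>x\<in>UNIV. card {y. y ^ 2 = x ^ 3 + a * x + b})"
proof -
  let ?cls = "\<lambda>v :: 'a \<times> 'a \<times> 'a. proj_rel `` {v}"
  let ?S = "SIGMA x:UNIV. {y. y ^ 2 = x ^ 3 + a * x + b}"
  let ?f = "\<lambda>(x, y). ?cls (x, y, 1)"
  have cls: "((X, Y, Z), (X', Y', Z')) \<in> proj_rel \<longleftrightarrow>
      (X, Y, Z) \<noteq> (0, 0, 0) \<and> (\<exists>c. c \<noteq> 0 \<and> X' = c * X \<and> Y' = c * Y \<and> Z' = c * Z)"
    for X Y Z X' Y' Z' :: 'a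
    by (simp add: proj_rel_def)
  have cls_eq: "?cls u = ?cls v" if "v \<in> ?cls u" for u v :: "'a \<times> 'a \<times> 'a"
    using equiv_class_eq[OF equiv_proj_rel] that by blast
  have "ell_points a b = insert (?cls (0, 1, 0)) (?f ` ?S)"
  proof (intro equalityI subsetI)
    fix P assume P: "P \<in> ell_points a b"
    then obtain X Y Z where v: "(X, Y, Z) \<noteq> (0, 0, 0)" "P = ?cls (X, Y, Z)"
      by (auto simp: ell_points_def proj_plane_def elim!: quotientE)
    then have "(X, Y, Z) \<in> P" by (auto simp: cls intro!: exI[of _ 1])
    then have E: "Y ^ 2 * Z = X ^ 3 + a * X * Z ^ 2 + b * Z ^ 3"
      using P by (auto simp: ell_points_def)
    show "P \<in> insert (?cls (0, 1, 0)) (?f ` ?S)"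
    proof (cases "Z = 0")
      case True
      then have "X = 0" using E by simp
      then have "(0, 1, 0) \<in> ?cls (X, Y, Z)"
        using True v(1) by (auto simp: cls intro!: exI[of _ "inverse Y"])
      then show ?thesis using cls_eq v(2) by blast
    next
      case False
      then have "(X / Z, Y / Z, 1) \<in> ?cls (X, Y, Z)"
        by (auto simp: cls intro!: exI[of _ "inverse Z"] simp: field_simps)
      then have "P = ?f (X / Z, Y / Z)" using cls_eq v(2) by auto
      moreover have "(Y / Z) ^ 2 = (X / Z) ^ 3 + a * (X / Z) + b"
      proof -
        have "(Y / Z) ^ 2 = Y ^ 2 * Z / Z ^ 3"
          using False by (simp add: power_divide power2_eq_square power3_eq_cube)
        also have "\<dots> = (X / Z) ^ 3 + a * (X / Z) + b"
          unfolding E using False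
          by (simp add: power_divide add_divide_distrib power2_eq_square power3_eq_cube)
        finally show ?thesis .
      qed
      ultimately show ?thesis by blast
    qed
  next
    fix P assume "P \<in> insert (?cls (0, 1, 0)) (?f ` ?S)"
    then consider "P = ?cls (0, 1, 0)" |
      x y where "P = ?cls (x, y, 1)" "y ^ 2 = x ^ 3 + a * x + b"
      by auto
    then show "P \<in> ell_points a b"
    proof cases
      case 1
      then show ?thesis
        by (auto simp: ell_points_def proj_plane_def cls intro!: quotientI)
    next
      case 2
      have "(c * y) ^ 2 * c = (c * x) ^ 3 + a * (c * x) * c ^ 2 + b * c ^ 3" for c
      proof -
        have "(c * y) ^ 2 * c = c ^ 3 * y ^ 2" by (simp add: power2_eq_square power3_eq_cube)
        then show ?thesis unfolding 2(2) by (simp add: algebra_simps power2_eq_square power3_eq_cube)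
      qed
      then show ?thesis using 2(1)
        by (auto simp: ell_points_def proj_plane_def cls intro!: quotientI)
    qed
  qed
  moreover have "?cls (0, 1, 0) \<notin> ?f ` ?S"
  proof
    assume "?cls (0, 1, 0) \<in> ?f ` ?S"
    then obtain x y where "?cls (0, 1, 0) = ?cls (x, y, 1)" by auto
    then have "(x, y, 1) \<in> ?cls (0, 1, 0)" by (auto simp: cls intro!: exI[of _ 1])
    then show False by (simp add: cls)
  qed
  moreover have "inj_on ?f ?S"
  proof (rule inj_onI, clarify)
    fix x y x' y' assume "?cls (x, y, 1) = ?cls (x', y', 1)"
    then have "(x', y', 1) \<in> ?cls (x, y, 1)" by (auto simp: cls intro!: exI[of _ 1])
    then show "x = x' \<and> y = y'" by (auto simp: cls)
  qed
  ultimately have "card (ell_points a b) = 1 + card ?S"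
    by (simp add: card_image)
  then show ?thesis by simp
qed

lemma (in order_12_char) frob_trace_eq:
  "of_int (frob_trace a b) = - (\<Sum>x\<in>UNIV. qr (x ^ 3 + a * x + b))"
proof -
  have "(\<Sum>x\<in>UNIV. of_nat (card {y. y ^ 2 = x ^ 3 + a * x + b}) :: complex) =
      (\<Sum>x\<in>UNIV. 1 + qr (x ^ 3 + a * x + b))"
    by (simp only: card_sqrt)
  then show ?thesis
    by (simp add: frob_trace_def card_ell_points sum.distrib)
qed

section \<open>From a character generator to an order 12 character\<close>

lemma char_generator_order_12:
  fixes T :: "'a :: finite_field \<Rightarrow> complex"
  assumes T: "char_generator T" and n: "CARD('a) - 1 = 12 * n"
  obtains \<zeta> where "order_12_char (\<lambda>x. T x ^ n) \<zeta>"
proof -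
  have Tm: "mult_char T" using T by (simp add: char_generator_def char_group_simps)
  have n0: "n > 0" using n finite_field_card_gt_1[where 'a = 'a] by (cases n) auto
  obtain g :: 'a where g: "g \<noteq> 0" "\<And>x. x \<noteq> 0 \<Longrightarrow> \<exists>i. x = g ^ i"
    by (rule finite_field_primitive_root) blast
  \<comment> \<open>For a primitive root \<open>g\<close> of a field with \<open>12 * n\<close>
    nonzero elements, this power has order 3.\<close>
  define \<zeta> where "\<zeta> = g ^ (4 * n)"
  have "\<zeta> \<noteq> 1"
  proof
    assume "\<zeta> = 1"
    then have "T g ^ (4 * n) = 1"
      using mult_char_pow[OF Tm, of "4 * n" g] n0 by (simp add: \<zeta>_def mult_char_1[OF Tm])
    then have "12 * n dvd 4 * n" using char_generator_primitive[OF T g] n by metis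
    then show False using n0 by (auto dest: dvd_imp_le)
  qed
  moreover have "\<zeta> ^ 3 = 1"
    using finite_field_power_card_minus_1[OF g(1)] n by (simp add: \<zeta>_def mult_ac flip: power_mult)
  then have "(\<zeta> - 1) * (\<zeta> ^ 2 + \<zeta> + 1) = 0"
    by (simp add: algebra_simps power3_eq_cube power2_eq_square)
  ultimately have \<zeta>: "\<zeta> ^ 2 + \<zeta> + 1 = 0" by simp
  \<comment> \<open>The field size \<open>12 * n + 1\<close> is zero in the field, which rules out
    characteristics 2 and 3.\<close>
  have "of_nat (CARD('a)) = (0 :: 'a)"
    using CHAR_dvd_CARD[where 'a = 'a] of_nat_eq_0_iff_char_dvd by blast
  moreover have "CARD('a) = 12 * n + 1" using n finite_field_card_gt_1[where 'a = 'a] by simp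
  ultimately have char: "12 * of_nat n + 1 = (0 :: 'a)" by (simp add: add.commute)
  have "order_12_char (\<lambda>x. T x ^ n) \<zeta>"
  proof
    show "mult_char (\<lambda>x. T x ^ n)"
      using mult_char_nat_pow[OF Tm, of n] unfolding mult_char_def char_group_nat_pow[OF Tm n0] .
    show "\<zeta> ^ 2 + \<zeta> + 1 = 0" by (rule \<zeta>)
    show "(T x ^ n) ^ 12 = 1" if "x \<noteq> 0" for x
      using mult_char_order[OF Tm that] n by (simp add: mult_ac flip: power_mult)
    show "\<exists>y. x = y ^ 2" if "x \<noteq> 0" "(T x ^ n) ^ 6 = 1" for x
      using char_generator_eq_1_imp_power[OF T that(1), of "n * 6" 2] that(2) n
      by (simp add: power_mult)
    show "\<exists>y. x = y ^ 3" if "x \<noteq> 0" "(T x ^ n) ^ 4 = 1" for x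
      using char_generator_eq_1_imp_power[OF T that(1), of "n * 4" 3] that(2) n
      by (simp add: power_mult)
    show "(2 :: 'a) \<noteq> 0"
    proof
      assume two: "(2 :: 'a) = 0"
      have "(12 :: 'a) = 2 * 6" by simp
      then show False using char two by (metis add_0 mult_zero_left one_neq_zero)
    qed
    show "(3 :: 'a) \<noteq> 0"
    proof
      assume three: "(3 :: 'a) = 0"
      have "(12 :: 'a) = 3 * 4" by simp
      then show False using char three by (metis add_0 mult_zero_left one_neq_zero)
    qed
  qed
  then show ?thesis by (rule that)
qed

section \<open>The trace formula\<close>

theorem theorem2p1:
  fixes p e q :: nat
    and a b :: "'a :: finite_field"
    and T :: "'a \<Rightarrow> complex"
  assumes "prime p" and "p > 3"
    and "q = p ^ e" and "CARD('a) = q" and "[q = 1] (mod 12)"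
    and "elliptic_curve a b"
    and "ell_j a b \<noteq> 0" and "ell_j a b \<noteq> 1728"
    and "char_generator T"
  shows "of_int (frob_trace a b) =
    - of_nat q * (T [^]\<^bsub>char_group\<^esub> ((q - 1) div 4)) (a ^ 3 / 27) *
      greene_2F1 (T [^]\<^bsub>char_group\<^esub> ((q - 1) div 12))
                 (T [^]\<^bsub>char_group\<^esub> (5 * (q - 1) div 12))
                 (T [^]\<^bsub>char_group\<^esub> ((q - 1) div 2))
                 (- (27 * b ^ 2) / (4 * a ^ 3))"
proof -
  define n where "n = (q - 1) div 12"
  have q1: "q > 1" using assms(4) finite_field_card_gt_1[where 'a = 'a] by simp
  have "12 dvd q - 1" using assms(5) q1 by (simp add: cong_altdef_nat)
  then have n: "q - 1 = 12 * n" by (simp add: n_def)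
  have n0: "n > 0" using n q1 by (cases n) auto
  define A where "A = (\<lambda>x. T x ^ n)"
  obtain \<zeta> where "order_12_char A \<zeta>"
    using char_generator_order_12[OF assms(9)] n assms(4) unfolding A_def by blast
  then interpret order_12_char A \<zeta> .
  have Tm: "mult_char T" using assms(9) by (simp add: char_generator_def char_group_simps)
  have pow: "T [^]\<^bsub>char_group\<^esub> (k * n) = (\<lambda>x. A x ^ k)" if "k > 0" for k
    using char_group_nat_pow[OF Tm, of "k * n"] that n0
    by (simp add: fun_eq_iff A_def mult.commute flip: power_mult)
  have mult_char_pow_A: "mult_char (\<lambda>x. A x ^ k)" if "k > 0" for k
    using mult_char_nat_pow[OF Tm, of "k * n"] pow[OF that] by simp
  have exps: "(q - 1) div 4 = 3 * n" "(q - 1) div 12 = 1 * n" "5 * (q - 1) div 12 = 5 * n"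
      "(q - 1) div 2 = 6 * n"
    using n by simp_all
  \<comment> \<open>Chosen so that \<open>a = - 3 * m\<close>, the normal form for Cardano's
    formula. Then \<open>a ^ 3 / 27 = - (m ^ 3)\<close>, and the hypergeometric argument becomes
    \<open>b ^ 2 / (4 * m ^ 3)\<close>.\<close>
  define m where "m = - a / 3"
  define x where "x = - (27 * b ^ 2) / (4 * a ^ 3)"
  have n27: "(27 :: 'a) \<noteq> 0"
  proof -
    have "(27 :: 'a) = 3 * 3 * 3" by simp
    then show ?thesis using three_neq_0 by (metis mult_eq_0_iff)
  qed
  have a: "a \<noteq> 0" using assms(7) by (auto simp: ell_j_def)
  have disc: "4 * a ^ 3 + 27 * b ^ 2 \<noteq> 0"
    using assms(6) unfolding elliptic_curve_def ell_disc_def by (metis mult_zero_right)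
  have b: "b \<noteq> 0"
  proof
    assume "b = 0"
    moreover have "(64 :: 'a) \<noteq> 0"
    proof -
      have "(64 :: 'a) = 4 * 4 * 4" by simp
      then show ?thesis using four_neq_0 by (metis mult_eq_0_iff)
    qed
    ultimately have "ell_j a b = 1728"
      using a by (simp add: ell_j_def ell_disc_def power_mult_distrib field_simps)
    then show False using assms(8) by simp
  qed
  have m: "m \<noteq> 0" "a = - 3 * m" using a three_neq_0 by (simp_all add: m_def)
  have a3: "a ^ 3 = - 27 * m ^ 3" by (simp add: m(2) power3_eq_cube)
  have m3: "a ^ 3 / 27 = - (m ^ 3)" using n27 by (simp add: a3)
  have x: "x = b ^ 2 / (4 * m ^ 3)"
  proof -
    have "x = (27 * b ^ 2) / (27 * (4 * m ^ 3))" by (simp add: x_def a3)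
    then show ?thesis by (simp only: mult_divide_mult_cancel_left[OF n27])
  qed
  \<comment> \<open>Nonsingularity of the curve says that the hypergeometric argument is not
    1.\<close>
  have bm: "b ^ 2 \<noteq> 4 * m ^ 3" using disc by (auto simp: a3)
  have x0: "x \<noteq> 0" using b m(1) four_neq_0 by (simp add: x)
  let ?F = "greene_2F1 (T [^]\<^bsub>char_group\<^esub> ((q - 1) div 12))
    (T [^]\<^bsub>char_group\<^esub> (5 * (q - 1) div 12)) (T [^]\<^bsub>char_group\<^esub> ((q - 1) div 2)) x"
  have "?F = greene_2F1 (\<lambda>x. A x ^ 1) (\<lambda>x. A x ^ 5) (\<lambda>x. A x ^ 6) x"
    unfolding exps by (simp only: pow zero_less_numeral zero_less_one)
  also have "\<dots> = 1 / of_nat q *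
      (\<Sum>t\<in>UNIV. A t ^ 5 * cnj (A (1 + t) ^ 5) * A (1 + t) ^ 6 * cnj (A (1 + x * t)))"
    using greene_2F1_eq_sum[OF assms(9) mult_char_pow_A[of 1] mult_char_pow_A[of 5]
        mult_char_pow_A[of 6] x0] qr_minus_1 by (simp add: qr_def assms(4))
  also have "(\<Sum>t\<in>UNIV. A t ^ 5 * cnj (A (1 + t) ^ 5) * A (1 + t) ^ 6 * cnj (A (1 + x * t))) =
      (\<Sum>t\<in>UNIV. A t ^ 5 * A (1 + t) * cnj (A (1 + x * t)))"
  proof (rule sum.cong[OF refl])
    fix t :: 'a
    \<comment> \<open>Five factors pair with their conjugates to 1. At \<open>1 + t = 0\<close> the
      remaining factor makes both sides 0.\<close>
    have "cnj (A (1 + t) ^ 5) * A (1 + t) ^ 6 = (A (1 + t) * cnj (A (1 + t))) ^ 5 * A (1 + t)"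
      by (simp add: power_mult_distrib eval_nat_numeral)
    also have "\<dots> = A (1 + t)"
      by (simp add: mult_char_mult_cnj[OF mult_char_A] A_0)
    finally show "A t ^ 5 * cnj (A (1 + t) ^ 5) * A (1 + t) ^ 6 * cnj (A (1 + x * t)) =
        A t ^ 5 * A (1 + t) * cnj (A (1 + x * t))"
      by (simp add: mult.assoc)
  qed
  finally have greene: "of_nat q * ?F =
      (\<Sum>t\<in>UNIV. A t ^ 5 * A (1 + t) * cnj (A (1 + x * t)))"
    using q1 by simp
  have "of_int (frob_trace a b) = - (\<Sum>X\<in>UNIV. qr (X ^ 3 - 3 * m * X + b))"
    by (simp add: frob_trace_eq m(2))
  also have "\<dots> = - (A (a ^ 3 / 27) ^ 3 * (\<Sum>t\<in>UNIV. A t ^ 5 * A (1 + t) * cnj (A (1 + x * t))))"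
    unfolding sum_qr_cubic_eq_hypergeometric_sum[OF m(1) b bm x] m3 ..
  also have "A (a ^ 3 / 27) ^ 3 = (T [^]\<^bsub>char_group\<^esub> ((q - 1) div 4)) (a ^ 3 / 27)"
    unfolding exps by (simp add: pow)
  finally show ?thesis
    unfolding greene[symmetric] x_def[symmetric]
    by (simp only: mult_minus_left mult.assoc mult.left_commute)
qed

end
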